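(* Let $\mathbb{E}$ be a regular category and let $n\geq 1$ be an integer. The following conditions are equivalent: 1) $\mathbb{E}$ is congruence $(n+1)$-permutable; 2) any reflexive relation $R$ on any object $X$ is such that $R^{n}$ is an equivalence relation.
   Context: A relation on $X$ is (a class up to isomorphism of) a subobject $R\rightarrowtail X\times X$, ordered by inclusion. In a regular category relations compose: $SR=S\circ R$ is the usual composite relation ($x(SR)z$ iff there is $y$ with $xRy$ and $ySz$), defined by a pullback followed by the regular epi–mono factorization; $R^n$ is the $n$-fold composite. $R$ is reflexive if $\Delta_X\subset R$; an equivalence relation is a reflexive relation with $R^{op}\subset R$ and $R\circ R\subset R$. For reflexive relations $R,S$ on $X$, $(R,S)_k$ is the alternating product of $k$ factors beginning with $R$: $(R,S)_1=R$, $(R,S)_2=RS$, $(R,S)_3=RSR$, etc. A regular category is congruence $k$-permutable when $(R,S)_k=(S,R)_k$ for any pair $(R,S)$ of equivalence relations on the same object. *)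

theory Defs
  imports Main
begin

section \<open>Categories and finite limits\<close>

record ('o, 'a) category_data =
  Ob :: "'o set"
  Ar :: "'a set"
  Dom :: "'a \<Rightarrow> 'o"
  Cod :: "'a \<Rightarrow> 'o"
  Id :: "'o \<Rightarrow> 'a"
  Comp :: "'a \<Rightarrow> 'a \<Rightarrow> 'a"  (infixl "\<cdot>\<index>" 70)

definition in_hom :: "('o, 'a) category_data \<Rightarrow> 'a \<Rightarrow> 'o \<Rightarrow> 'o \<Rightarrow> bool" where
  "in_hom C f X Y \<longleftrightarrow> f \<in> Ar C \<and> Dom C f = X \<and> Cod C f = Y"

locale category =
  fixes C :: "('o, 'a) category_data" (structure)
  assumes dom_Ob: "f \<in> Ar C \<Longrightarrow> Dom C f \<in> Ob C"
    and cod_Ob: "f \<in> Ar C \<Longrightarrow> Cod C f \<in> Ob C"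
    and id_in_hom: "X \<in> Ob C \<Longrightarrow> in_hom C (Id C X) X X"
    and comp_in_hom: "in_hom C f X Y \<Longrightarrow> in_hom C g Y Z \<Longrightarrow> in_hom C (g \<cdot> f) X Z"
    and id_left: "in_hom C f X Y \<Longrightarrow> Id C Y \<cdot> f = f"
    and id_right: "in_hom C f X Y \<Longrightarrow> f \<cdot> Id C X = f"
    and comp_assoc: "in_hom C f W X \<Longrightarrow> in_hom C g X Y \<Longrightarrow> in_hom C h Y Z
        \<Longrightarrow> (h \<cdot> g) \<cdot> f = h \<cdot> (g \<cdot> f)"

definition is_functor ::
  "('i, 'j) category_data \<Rightarrow> ('o, 'a) category_data \<Rightarrow> ('i \<Rightarrow> 'o) \<Rightarrow> ('j \<Rightarrow> 'a) \<Rightarrow> bool" where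
  "is_functor J C Fo Fa \<longleftrightarrow>
     (\<forall>i\<in>Ob J. Fo i \<in> Ob C) \<and>
     (\<forall>u i j. in_hom J u i j \<longrightarrow> in_hom C (Fa u) (Fo i) (Fo j)) \<and>
     (\<forall>i\<in>Ob J. Fa (Id J i) = Id C (Fo i)) \<and>
     (\<forall>u v i j k. in_hom J u i j \<and> in_hom J v j k \<longrightarrow>
        Fa (v \<cdot>\<^bsub>J\<^esub> u) = Fa v \<cdot>\<^bsub>C\<^esub> Fa u)"

definition is_cone ::
  "('i, 'j) category_data \<Rightarrow> ('o, 'a) category_data \<Rightarrow> ('i \<Rightarrow> 'o) \<Rightarrow> ('j \<Rightarrow> 'a)
     \<Rightarrow> 'o \<Rightarrow> ('i \<Rightarrow> 'a) \<Rightarrow> bool" where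
  "is_cone J C Fo Fa L l \<longleftrightarrow>
     L \<in> Ob C \<and> (\<forall>i\<in>Ob J. in_hom C (l i) L (Fo i)) \<and>
     (\<forall>u i j. in_hom J u i j \<longrightarrow> Fa u \<cdot>\<^bsub>C\<^esub> l i = l j)"

definition is_limit ::
  "('i, 'j) category_data \<Rightarrow> ('o, 'a) category_data \<Rightarrow> ('i \<Rightarrow> 'o) \<Rightarrow> ('j \<Rightarrow> 'a)
     \<Rightarrow> 'o \<Rightarrow> ('i \<Rightarrow> 'a) \<Rightarrow> bool" where
  "is_limit J C Fo Fa L l \<longleftrightarrow>
     is_cone J C Fo Fa L l \<and>
     (\<forall>K k. is_cone J C Fo Fa K k \<longrightarrow>
        (\<exists>!h. in_hom C h K L \<and> (\<forall>i\<in>Ob J. l i \<cdot>\<^bsub>C\<^esub> h = k i)))"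

text \<open>Index categories may be taken with objects and arrows in \<^typ>\<open>nat\<close>, since every finite
  category is isomorphic to such a one.\<close>

definition finitely_complete :: "('o, 'a) category_data \<Rightarrow> bool" where
  "finitely_complete C \<longleftrightarrow>
     (\<forall>(J :: (nat, nat) category_data) Fo Fa.
        category J \<and> finite (Ob J) \<and> finite (Ar J) \<and> is_functor J C Fo Fa \<longrightarrow>
        (\<exists>L l. is_limit J C Fo Fa L l))"

section \<open>Regular categories\<close>

definition is_mono :: "('o, 'a) category_data \<Rightarrow> 'a \<Rightarrow> bool" where
  "is_mono C m \<longleftrightarrow> m \<in> Ar C \<and>
     (\<forall>W f g. in_hom C f W (Dom C m) \<and> in_hom C g W (Dom C m) \<and>
        m \<cdot>\<^bsub>C\<^esub> f = m \<cdot>\<^bsub>C\<^esub> g \<longrightarrow> f = g)"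

definition is_iso :: "('o, 'a) category_data \<Rightarrow> 'a \<Rightarrow> 'o \<Rightarrow> 'o \<Rightarrow> bool" where
  "is_iso C f X Y \<longleftrightarrow> in_hom C f X Y \<and>
     (\<exists>g. in_hom C g Y X \<and> g \<cdot>\<^bsub>C\<^esub> f = Id C X \<and> f \<cdot>\<^bsub>C\<^esub> g = Id C Y)"

definition is_pullback ::
  "('o, 'a) category_data \<Rightarrow> 'a \<Rightarrow> 'a \<Rightarrow> 'a \<Rightarrow> 'a \<Rightarrow> bool" where
  \<comment> \<open>\<open>p\<close>, \<open>q\<close> form a pullback cone over the cospan \<open>f\<close>, \<open>g\<close>, i.e. \<open>f p = g q\<close> universally\<close>
  "is_pullback C f g p q \<longleftrightarrow>
     f \<in> Ar C \<and> g \<in> Ar C \<and> Cod C f = Cod C g \<and>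
     in_hom C p (Dom C p) (Dom C f) \<and> in_hom C q (Dom C p) (Dom C g) \<and>
     f \<cdot>\<^bsub>C\<^esub> p = g \<cdot>\<^bsub>C\<^esub> q \<and>
     (\<forall>W a b. in_hom C a W (Dom C f) \<and> in_hom C b W (Dom C g) \<and>
        f \<cdot>\<^bsub>C\<^esub> a = g \<cdot>\<^bsub>C\<^esub> b \<longrightarrow>
        (\<exists>!h. in_hom C h W (Dom C p) \<and> p \<cdot>\<^bsub>C\<^esub> h = a \<and> q \<cdot>\<^bsub>C\<^esub> h = b))"

definition is_coequalizer :: "('o, 'a) category_data \<Rightarrow> 'a \<Rightarrow> 'a \<Rightarrow> 'a \<Rightarrow> bool" where
  "is_coequalizer C a b e \<longleftrightarrow>
     a \<in> Ar C \<and> in_hom C b (Dom C a) (Cod C a) \<and> in_hom C e (Cod C a) (Cod C e) \<and>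
     e \<cdot>\<^bsub>C\<^esub> a = e \<cdot>\<^bsub>C\<^esub> b \<and>
     (\<forall>Z f. in_hom C f (Cod C a) Z \<and> f \<cdot>\<^bsub>C\<^esub> a = f \<cdot>\<^bsub>C\<^esub> b \<longrightarrow>
        (\<exists>!h. in_hom C h (Cod C e) Z \<and> h \<cdot>\<^bsub>C\<^esub> e = f))"

definition is_regular_epi :: "('o, 'a) category_data \<Rightarrow> 'a \<Rightarrow> bool" where
  "is_regular_epi C e \<longleftrightarrow> (\<exists>a b. is_coequalizer C a b e)"

locale regular_category = category +
  assumes finitely_complete: "finitely_complete C"
    and kernel_pair_coequalizer: "is_pullback C f f p q \<Longrightarrow> \<exists>e. is_coequalizer C p q e"
    and regular_epi_stable: "is_pullback C f g p q \<Longrightarrow> is_regular_epi C f \<Longrightarrow> is_regular_epi C q"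

section \<open>Relations\<close>

definition is_square ::
  "('o, 'a) category_data \<Rightarrow> 'o \<Rightarrow> 'o \<Rightarrow> 'a \<Rightarrow> 'a \<Rightarrow> bool" where
  \<comment> \<open>\<open>P\<close> with projections \<open>p\<close>, \<open>q\<close> is a product of \<open>X\<close> with itself\<close>
  "is_square C X P p q \<longleftrightarrow>
     in_hom C p P X \<and> in_hom C q P X \<and>
     (\<forall>W a b. in_hom C a W X \<and> in_hom C b W X \<longrightarrow>
        (\<exists>!h. in_hom C h W P \<and> p \<cdot>\<^bsub>C\<^esub> h = a \<and> q \<cdot>\<^bsub>C\<^esub> h = b))"

text \<open>A choice of the product \<open>X \<times> X\<close>; the chosen projections are those of one and the same
  product because they are components of a single chosen triple.\<close>

definition square_cone :: "('o, 'a) category_data \<Rightarrow> 'o \<Rightarrow> 'o \<times> 'a \<times> 'a" where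
  "square_cone C X = (SOME (P, p, q). is_square C X P p q)"

definition square :: "('o, 'a) category_data \<Rightarrow> 'o \<Rightarrow> 'o" where
  "square C X = fst (square_cone C X)"

definition proj1 :: "('o, 'a) category_data \<Rightarrow> 'o \<Rightarrow> 'a" where
  "proj1 C X = fst (snd (square_cone C X))"

definition proj2 :: "('o, 'a) category_data \<Rightarrow> 'o \<Rightarrow> 'a" where
  "proj2 C X = snd (snd (square_cone C X))"

definition pairing :: "('o, 'a) category_data \<Rightarrow> 'o \<Rightarrow> 'a \<Rightarrow> 'a \<Rightarrow> 'a" where
  "pairing C X a b = (THE h. in_hom C h (Dom C a) (square C X) \<and>
     proj1 C X \<cdot>\<^bsub>C\<^esub> h = a \<and> proj2 C X \<cdot>\<^bsub>C\<^esub> h = b)"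

text \<open>Subobjects are isomorphism classes of monomorphisms, represented as sets of arrows, so that
  equality of relations is equality of sets.\<close>

definition subobject_class :: "('o, 'a) category_data \<Rightarrow> 'a \<Rightarrow> 'a set" where
  "subobject_class C m = {m \<cdot>\<^bsub>C\<^esub> h | h W. is_iso C h W (Dom C m)}"

definition relations :: "('o, 'a) category_data \<Rightarrow> 'o \<Rightarrow> 'a set set" where
  "relations C X = {subobject_class C m | m. is_mono C m \<and> Cod C m = square C X}"

definition rel_le :: "('o, 'a) category_data \<Rightarrow> 'a set \<Rightarrow> 'a set \<Rightarrow> bool" where
  "rel_le C R S \<longleftrightarrow>
     (\<exists>r\<in>R. \<exists>s\<in>S. \<exists>h. in_hom C h (Dom C r) (Dom C s) \<and> r = s \<cdot>\<^bsub>C\<^esub> h)"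

definition diagonal :: "('o, 'a) category_data \<Rightarrow> 'o \<Rightarrow> 'a set" where
  "diagonal C X = subobject_class C (pairing C X (Id C X) (Id C X))"

definition rel_op :: "('o, 'a) category_data \<Rightarrow> 'o \<Rightarrow> 'a set \<Rightarrow> 'a set" where
  "rel_op C X R = {pairing C X (proj2 C X \<cdot>\<^bsub>C\<^esub> r) (proj1 C X \<cdot>\<^bsub>C\<^esub> r) | r. r \<in> R}"

text \<open>\<open>rel_comp C X S R\<close> is \<open>S R\<close>: first \<open>R\<close>, then \<open>S\<close>.  For representatives \<open>r = (r1, r2)\<close> and
  \<open>s = (s1, s2)\<close>, with \<open>p\<close>, \<open>q\<close> the pullback of \<open>r2\<close> and \<open>s1\<close>, it consists of the monic parts of the
  regular epi-mono factorizations of \<open>(r1 p, s2 q)\<close>; taken over all choices, these make up exactly one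
  isomorphism class.\<close>

definition rel_comp :: "('o, 'a) category_data \<Rightarrow> 'o \<Rightarrow> 'a set \<Rightarrow> 'a set \<Rightarrow> 'a set" where
  "rel_comp C X S R =
     {m. \<exists>r\<in>R. \<exists>s\<in>S. \<exists>p q e.
        is_pullback C (proj2 C X \<cdot>\<^bsub>C\<^esub> r) (proj1 C X \<cdot>\<^bsub>C\<^esub> s) p q \<and>
        is_regular_epi C e \<and> is_mono C m \<and> Cod C e = Dom C m \<and>
        m \<cdot>\<^bsub>C\<^esub> e =
          pairing C X ((proj1 C X \<cdot>\<^bsub>C\<^esub> r) \<cdot>\<^bsub>C\<^esub> p) ((proj2 C X \<cdot>\<^bsub>C\<^esub> s) \<cdot>\<^bsub>C\<^esub> q)}"

fun rel_pow :: "('o, 'a) category_data \<Rightarrow> 'o \<Rightarrow> 'a set \<Rightarrow> nat \<Rightarrow> 'a set" where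
  "rel_pow C X R 0 = diagonal C X"
| "rel_pow C X R (Suc 0) = R"
| "rel_pow C X R (Suc (Suc n)) = rel_comp C X R (rel_pow C X R (Suc n))"

text \<open>The alternating product \<open>(R, S)\<^sub>k\<close> of \<open>k\<close> factors; only \<open>k \<ge> 1\<close> matters.\<close>

fun alternating :: "('o, 'a) category_data \<Rightarrow> 'o \<Rightarrow> 'a set \<Rightarrow> 'a set \<Rightarrow> nat \<Rightarrow> 'a set" where
  "alternating C X R S 0 = diagonal C X"
| "alternating C X R S (Suc 0) = R"
| "alternating C X R S (Suc (Suc k)) = rel_comp C X R (alternating C X S R (Suc k))"

definition reflexive_relation :: "('o, 'a) category_data \<Rightarrow> 'o \<Rightarrow> 'a set \<Rightarrow> bool" where
  "reflexive_relation C X R \<longleftrightarrow> R \<in> relations C X \<and> rel_le C (diagonal C X) R"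

definition equivalence_relation :: "('o, 'a) category_data \<Rightarrow> 'o \<Rightarrow> 'a set \<Rightarrow> bool" where
  "equivalence_relation C X R \<longleftrightarrow>
     reflexive_relation C X R \<and> rel_le C (rel_op C X R) R \<and> rel_le C (rel_comp C X R R) R"

definition congruence_permutable :: "('o, 'a) category_data \<Rightarrow> nat \<Rightarrow> bool" where
  "congruence_permutable C k \<longleftrightarrow>
     (\<forall>X\<in>Ob C. \<forall>R S. equivalence_relation C X R \<and> equivalence_relation C X S \<longrightarrow>
        alternating C X R S k = alternating C X S R k)"

end

theory Submission
  imports Defs
begin

text \<open>A relation \<open>R\<close> on \<open>X\<close> is determined by the pairs of arrows \<open>a, b: W \<rightarrow> X\<close> that factor jointly
  through it, written \<open>related X R W a b\<close> below.  In these terms relations behave like relations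
  between elements, except that existence is local: \<open>a\<close> and \<open>c\<close> are related by \<open>S R\<close> iff some cover
  \<open>d: V \<rightarrow> W\<close> carries a \<open>b\<close> with \<open>a d\<close>, \<open>b\<close> related by \<open>R\<close> and \<open>b\<close>, \<open>c d\<close> by \<open>S\<close>
  (\<open>related_rel_comp\<close>).  Being related may be tested on a cover (\<open>related_descent\<close>), so an argument
  that picks intermediate elements can be carried out on a cover and descended at the end.  Both
  implications are arguments with elements of this kind, and both use an object of paths.

  Suppose congruences \<open>(n+1)\<close>-permute and \<open>E\<close> is reflexive.  Let \<open>P\<close> be the object of \<open>E\<close>-paths
  \<open>(x\<^sub>0, \<dots>, x\<^sub>n)\<close>, with the two equivalence relations of agreeing in all even coordinates and in all odd
  coordinates.  If two paths \<open>v\<close> and \<open>u\<close> are such that also \<open>u\<^sub>l E v\<^sub>l\<^sub>+\<^sub>1\<close> throughout, then \<open>v\<close> can be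
  turned into \<open>u\<close> through paths, one coordinate after the other from left to right; the steps
  alternate between the two congruences.  Permutability gives a second alternating sequence
  \<open>p\<^sub>0 = v, \<dots>, p\<^sub>n\<^sub>+\<^sub>1 = u\<close> of paths, in which now the \<open>i\<close>-th step preserves coordinate \<open>i\<close>.  The common
  \<open>i\<close>-th coordinates of \<open>p\<^sub>i\<close> and \<open>p\<^sub>i\<^sub>+\<^sub>1\<close> form an \<open>E\<close>-path of length \<open>n\<close> from \<open>v\<^sub>0\<close> to \<open>u\<^sub>n\<close>
  (\<open>related_alternating_path_swap\<close>).  Two choices of \<open>u\<close> and \<open>v\<close> yield \<open>E\<^sup>n\<^sup>+\<^sup>1 \<subseteq> E\<^sup>n\<close> and
  \<open>E\<^sup>o\<^sup>p \<subseteq> E\<^sup>n\<close>, hence \<open>E\<^sup>n\<close> is transitive and symmetric.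

  Conversely let \<open>R\<close>, \<open>S\<close> be equivalence relations, put \<open>T\<^sub>i = R\<close> for even and \<open>T\<^sub>i = S\<close> for odd \<open>i\<close>, and
  let \<open>c\<^sub>0, \<dots>, c\<^sub>n\<^sub>+\<^sub>1\<close> be a chain with \<open>c\<^sub>i T\<^sub>i c\<^sub>i\<^sub>+\<^sub>1\<close>.  On the object of paths \<open>(x\<^sub>0, \<dots>, x\<^sub>n\<^sub>-\<^sub>1)\<close> with
  \<open>x\<^sub>i T\<^sub>i x\<^sub>i\<^sub>+\<^sub>1\<close>, relate \<open>x\<close> to \<open>y\<close> when \<open>x\<^sub>i\<close> and \<open>y\<^sub>i\<close> are related by \<open>T\<^sub>i\<close> followed by \<open>T\<^sub>i\<^sub>+\<^sub>1\<close> for every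
  \<open>i\<close>.  This reflexive relation \<open>E\<close> relates \<open>x = (c\<^sub>0, \<dots>, c\<^sub>n\<^sub>-\<^sub>1)\<close> to \<open>y = (c\<^sub>2, \<dots>, c\<^sub>n\<^sub>+\<^sub>1)\<close>, so if \<open>E\<^sup>n\<close> is
  symmetric then an \<open>E\<close>-path of length \<open>n\<close> leads back from \<open>y\<close> to \<open>x\<close>.  Follow it, moving one
  coordinate to the left after each step: adjacent uses of the same equivalence relation merge, and
  what remains is an alternating chain of length \<open>n + 1\<close> from \<open>c\<^sub>n\<^sub>+\<^sub>1\<close> to \<open>c\<^sub>0\<close> that starts with the other
  relation (\<open>rel_pow_equivalence_imp_alternating_le\<close>).\<close>

section \<open>Arrows, pullbacks and squares\<close>

context category
begin

text \<open>Typing is phrased with \<open>Dom\<close> and \<open>Cod\<close> here, so that the simplifier can discharge it and normalize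
  composites to the right.\<close>

lemma comp_simps [simp]:
  assumes "f \<in> Ar C" "g \<in> Ar C" "Cod C f = Dom C g"
  shows "g \<cdot> f \<in> Ar C" "Dom C (g \<cdot> f) = Dom C f" "Cod C (g \<cdot> f) = Cod C g"
  using comp_in_hom[of f "Dom C f" "Cod C f" g "Cod C g"] assms by (auto simp: in_hom_def)

lemma comp_assoc_arrows [simp]:
  assumes "f \<in> Ar C" "g \<in> Ar C" "h \<in> Ar C" "Cod C f = Dom C g" "Cod C g = Dom C h"
  shows "(h \<cdot> g) \<cdot> f = h \<cdot> (g \<cdot> f)"
  using comp_assoc[of f "Dom C f" "Cod C f" g "Cod C g" h "Cod C h"] assms
  by (auto simp: in_hom_def)

lemma id_simps [simp]:
  assumes "X \<in> Ob C"
  shows "Id C X \<in> Ar C" "Dom C (Id C X) = X" "Cod C (Id C X) = X"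
  using id_in_hom[OF assms] by (auto simp: in_hom_def)

lemma id_comp_simps [simp]:
  assumes "f \<in> Ar C"
  shows "Dom C f = X \<Longrightarrow> f \<cdot> Id C X = f" "Cod C f = Y \<Longrightarrow> Id C Y \<cdot> f = f"
  using assms id_right[of f "Dom C f" "Cod C f"] id_left[of f "Dom C f" "Cod C f"]
  by (auto simp: in_hom_def)

declare dom_Ob [simp] cod_Ob [simp]

lemma is_monoD:
  assumes "is_mono C m" "in_hom C f W (Dom C m)" "in_hom C g W (Dom C m)" "m \<cdot> f = m \<cdot> g"
  shows "f = g"
  using assms unfolding is_mono_def by blast

lemma is_mono_Ar: "is_mono C m \<Longrightarrow> m \<in> Ar C"
  by (simp add: is_mono_def)

lemma is_monoI:
  assumes "m \<in> Ar C"
    and "\<And>W f g. in_hom C f W (Dom C m) \<Longrightarrow> in_hom C g W (Dom C m) \<Longrightarrow> m \<cdot> f = m \<cdot> g \<Longrightarrow> f = g"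
  shows "is_mono C m"
  using assms unfolding is_mono_def by blast

lemma comp_mono:
  assumes "is_mono C m" "is_mono C k" "Cod C k = Dom C m"
  shows "is_mono C (m \<cdot> k)"
proof (rule is_monoI)
  note ar = is_mono_Ar[OF assms(1)] is_mono_Ar[OF assms(2)] assms(3)
  show "m \<cdot> k \<in> Ar C" using ar by simp
  fix W f g
  assume fg: "in_hom C f W (Dom C (m \<cdot> k))" "in_hom C g W (Dom C (m \<cdot> k))"
    and eq: "(m \<cdot> k) \<cdot> f = (m \<cdot> k) \<cdot> g"
  have fg': "in_hom C f W (Dom C k)" "in_hom C g W (Dom C k)" using fg ar by simp_all
  then have "m \<cdot> (k \<cdot> f) = m \<cdot> (k \<cdot> g)" using eq ar by (simp add: in_hom_def)
  moreover have "in_hom C (k \<cdot> f) W (Dom C m)" "in_hom C (k \<cdot> g) W (Dom C m)"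
    using fg' ar by (simp_all add: in_hom_def)
  ultimately have "k \<cdot> f = k \<cdot> g" using is_monoD[OF assms(1)] by blast
  then show "f = g" using is_monoD[OF assms(2)] fg' by blast
qed

lemma iso_mono:
  assumes "is_iso C h V W"
  shows "is_mono C h"
proof -
  obtain k where k: "in_hom C h V W" "in_hom C k W V" "k \<cdot> h = Id C V"
    using assms by (auto simp: is_iso_def)
  have "f = g" if f: "in_hom C f Z V" and g: "in_hom C g Z V" and eq: "h \<cdot> f = h \<cdot> g" for Z f g
  proof -
    have "f = (k \<cdot> h) \<cdot> f" using k(3) f by (simp add: in_hom_def)
    also have "\<dots> = k \<cdot> (h \<cdot> f)" using k(1,2) f by (simp add: in_hom_def)
    also have "\<dots> = k \<cdot> (h \<cdot> g)" by (simp only: eq)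
    also have "\<dots> = (k \<cdot> h) \<cdot> g" using k(1,2) g by (simp add: in_hom_def)
    also have "\<dots> = g" using k(3) g by (simp add: in_hom_def)
    finally show ?thesis .
  qed
  then show ?thesis using k(1) by (intro is_monoI) (simp_all add: in_hom_def)
qed

lemma coequalizer_epi:
  assumes "is_coequalizer C a b e" "in_hom C f (Cod C e) Z" "in_hom C g (Cod C e) Z" "f \<cdot> e = g \<cdot> e"
  shows "f = g"
proof -
  note c = assms(1)[unfolded is_coequalizer_def]
  have ar: "a \<in> Ar C" "b \<in> Ar C" "e \<in> Ar C" "Dom C b = Dom C a" "Cod C b = Cod C a" "Dom C e = Cod C a"
    using c by (auto simp: in_hom_def)
  have "in_hom C (f \<cdot> e) (Cod C a) Z" "(f \<cdot> e) \<cdot> a = (f \<cdot> e) \<cdot> b"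
    using ar assms(2) c by (auto simp: in_hom_def)
  then have "\<exists>!h. in_hom C h (Cod C e) Z \<and> h \<cdot> e = f \<cdot> e" using c by blast
  then show ?thesis using assms by auto
qed

lemma regular_epi_Ar: "is_regular_epi C e \<Longrightarrow> e \<in> Ar C"
  by (auto simp: is_regular_epi_def is_coequalizer_def in_hom_def)

lemma regular_epi_epi:
  assumes "is_regular_epi C e" "in_hom C f (Cod C e) Z" "in_hom C g (Cod C e) Z" "f \<cdot> e = g \<cdot> e"
  shows "f = g"
  using assms coequalizer_epi unfolding is_regular_epi_def by blast

text \<open>Needed to see that the composite of two relations, defined by all possible factorizations, is
  closed under isomorphism.\<close>

lemma iso_regular_epi:
  assumes e: "is_regular_epi C e" and k: "is_iso C k (Cod C e) V"
  shows "is_regular_epi C (k \<cdot> e)"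
proof -
  obtain a b where c: "is_coequalizer C a b e" using e by (auto simp: is_regular_epi_def)
  obtain l where l: "in_hom C k (Cod C e) V" "in_hom C l V (Cod C e)" "l \<cdot> k = Id C (Cod C e)" "k \<cdot> l = Id C V"
    using k by (auto simp: is_iso_def)
  have ar: "a \<in> Ar C" "b \<in> Ar C" "e \<in> Ar C" "Dom C b = Dom C a" "Cod C b = Cod C a" "Dom C e = Cod C a"
      "e \<cdot> a = e \<cdot> b"
    using c by (auto simp: in_hom_def is_coequalizer_def)
  have lar: "k \<in> Ar C" "l \<in> Ar C" "Dom C k = Cod C e" "Cod C k = V" "Dom C l = V" "Cod C l = Cod C e"
    using l by (auto simp: in_hom_def)
  have "\<exists>!h. in_hom C h V Z \<and> h \<cdot> (k \<cdot> e) = f"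
    if f: "in_hom C f (Cod C a) Z" "f \<cdot> a = f \<cdot> b" for Z f
  proof -
    obtain h where h: "in_hom C h (Cod C e) Z" "h \<cdot> e = f"
      using c f unfolding is_coequalizer_def by blast
    have "(h \<cdot> l) \<cdot> (k \<cdot> e) = h \<cdot> ((l \<cdot> k) \<cdot> e)"
      using h(1) lar ar by (simp add: in_hom_def)
    then have 1: "in_hom C (h \<cdot> l) V Z \<and> (h \<cdot> l) \<cdot> (k \<cdot> e) = f"
      using h lar ar l by (simp add: in_hom_def)
    have "h' = h \<cdot> l" if h': "in_hom C h' V Z" "h' \<cdot> (k \<cdot> e) = f" for h'
    proof -
      have eq: "(h' \<cdot> k) \<cdot> e = h \<cdot> e" using h h' lar ar by (simp add: in_hom_def)
      have "in_hom C (h' \<cdot> k) (Cod C e) Z" using h'(1) lar by (simp add: in_hom_def)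
      then have "h' \<cdot> k = h" using coequalizer_epi[OF c _ h(1) eq] by blast
      then have "h \<cdot> l = (h' \<cdot> k) \<cdot> l" by simp
      also have "\<dots> = h' \<cdot> (k \<cdot> l)" using h'(1) lar by (simp add: in_hom_def)
      finally have "h \<cdot> l = h' \<cdot> (k \<cdot> l)" .
      then show ?thesis using l h' by (simp add: in_hom_def)
    qed
    with 1 show ?thesis by blast
  qed
  then have "is_coequalizer C a b (k \<cdot> e)"
    using ar lar by (simp add: is_coequalizer_def in_hom_def)
  then show ?thesis by (auto simp: is_regular_epi_def)
qed

lemma pullback_mono:
  assumes "is_pullback C f g p q" "is_mono C f"
  shows "is_mono C q"
proof -
  have ar: "f \<in> Ar C" "g \<in> Ar C" "p \<in> Ar C" "q \<in> Ar C" "Cod C f = Cod C g" "Dom C q = Dom C p"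
    "Cod C p = Dom C f" "Cod C q = Dom C g" and eq: "f \<cdot> p = g \<cdot> q"
    using assms(1) by (auto simp: is_pullback_def in_hom_def)
  have "u = v" if u: "in_hom C u W (Dom C p)" and v: "in_hom C v W (Dom C p)" and uv: "q \<cdot> u = q \<cdot> v" for W u v
  proof -
    have "f \<cdot> (p \<cdot> u) = (f \<cdot> p) \<cdot> u" using ar u by (simp add: in_hom_def)
    also have "\<dots> = (g \<cdot> q) \<cdot> v" using ar u v uv eq by (simp add: in_hom_def)
    also have "\<dots> = (f \<cdot> p) \<cdot> v" using eq by simp
    also have "\<dots> = f \<cdot> (p \<cdot> v)" using ar v by (simp add: in_hom_def)
    finally have eq1: "f \<cdot> (p \<cdot> u) = f \<cdot> (p \<cdot> v)" .
    have "p \<cdot> u = p \<cdot> v"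
      by (rule is_monoD[OF assms(2) _ _ eq1, of W]) (use ar u v in \<open>auto simp: in_hom_def\<close>)
    moreover have "in_hom C (p \<cdot> v) W (Dom C f)" "in_hom C (q \<cdot> v) W (Dom C g)"
      "f \<cdot> (p \<cdot> v) = g \<cdot> (q \<cdot> v)"
      using ar v eq comp_assoc_arrows[of v p f] comp_assoc_arrows[of v q g] by (auto simp: in_hom_def)
    then have "\<exists>!h. in_hom C h W (Dom C p) \<and> p \<cdot> h = p \<cdot> v \<and> q \<cdot> h = q \<cdot> v"
      using assms(1) unfolding is_pullback_def by blast
    ultimately show ?thesis using u v uv by metis
  qed
  then show ?thesis using ar by (intro is_monoI) simp_all
qed

end

definition discrete_two :: "(nat, nat) category_data" where
  "discrete_two = \<lparr>Ob = {0, 1}, Ar = {0, 1}, Dom = id, Cod = id, Id = id, Comp = (\<lambda>g f. f)\<rparr>"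

text \<open>The arrows \<open>0\<close>, \<open>1\<close>, \<open>2\<close> are the identities, \<open>3\<close> and \<open>4\<close> the legs of the cospan
  \<open>0 \<rightarrow> 2 \<leftarrow> 1\<close>.\<close>

definition walking_cospan :: "(nat, nat) category_data" where
  "walking_cospan = \<lparr>Ob = {0, 1, 2}, Ar = {0, 1, 2, 3, 4},
     Dom = (\<lambda>u. if u = 3 then 0 else if u = 4 then 1 else u),
     Cod = (\<lambda>u. if u = 3 \<or> u = 4 then 2 else u),
     Id = id, Comp = (\<lambda>g f. if f = 3 \<or> f = 4 then f else g)\<rparr>"

lemma category_discrete_two: "category discrete_two"
  by unfold_locales (auto simp: discrete_two_def in_hom_def)

lemma category_walking_cospan: "category walking_cospan"
  by unfold_locales (auto simp: walking_cospan_def in_hom_def split: if_splits)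

context regular_category
begin

lemma pullback_exists:
  assumes f: "in_hom C f A Z" and g: "in_hom C g B Z"
  obtains p q where "is_pullback C f g p q"
proof -
  define Fo where "Fo = (\<lambda>i::nat. if i = 0 then A else if i = 1 then B else Z)"
  define Fa where "Fa = (\<lambda>u::nat. if u = 3 then f else if u = 4 then g else Id C (Fo u))"
  have fn: "is_functor walking_cospan C Fo Fa"
    using f g unfolding is_functor_def walking_cospan_def in_hom_def Fo_def Fa_def
    by (auto split: if_splits)
  have "finite (Ob walking_cospan)" "finite (Ar walking_cospan)"
    by (auto simp: walking_cospan_def)
  then obtain L l where lim: "is_limit walking_cospan C Fo Fa L l"
    using finitely_complete category_walking_cospan fn unfolding finitely_complete_def by blast
  have hom3: "in_hom walking_cospan 3 0 2" "in_hom walking_cospan 4 1 2" and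
    ob: "Ob walking_cospan = {0, 1, 2}"
    by (auto simp: walking_cospan_def in_hom_def)
  have cone: "is_cone walking_cospan C Fo Fa L l" using lim by (auto simp: is_limit_def)
  have "\<forall>i\<in>Ob walking_cospan. in_hom C (l i) L (Fo i)"
    using cone unfolding is_cone_def by blast
  then have l: "in_hom C (l 0) L A" "in_hom C (l 1) L B" "in_hom C (l 2) L Z"
    by (simp_all add: ob Fo_def)
  have "Fa 3 \<cdot> l 0 = l 2" "Fa 4 \<cdot> l 1 = l 2"
    using cone hom3 unfolding is_cone_def by blast+
  then have eq: "f \<cdot> l 0 = l 2" "g \<cdot> l 1 = l 2"
    by (simp_all add: Fa_def)
  have "\<exists>!h. in_hom C h W L \<and> l 0 \<cdot> h = a \<and> l 1 \<cdot> h = b"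
    if a: "in_hom C a W A" and b: "in_hom C b W B" and ab: "f \<cdot> a = g \<cdot> b" for W a b
  proof -
    define k where "k = (\<lambda>i::nat. if i = 0 then a else if i = 1 then b else f \<cdot> a)"
    have "is_cone walking_cospan C Fo Fa W k"
      using a b ab f g
      unfolding is_cone_def k_def Fo_def Fa_def walking_cospan_def in_hom_def
      by (auto split: if_splits)
    then have ex: "\<exists>!h. in_hom C h W L \<and> (\<forall>i\<in>Ob walking_cospan. l i \<cdot> h = k i)"
      using lim by (auto simp: is_limit_def)
    have "l 2 \<cdot> h = f \<cdot> a" if "in_hom C h W L" "l 0 \<cdot> h = a" for h
      using that l f comp_assoc_arrows[of h "l 0" f] eq by (simp add: in_hom_def)
    then have "(in_hom C h W L \<and> (\<forall>i\<in>Ob walking_cospan. l i \<cdot> h = k i)) \<longleftrightarrow>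
      (in_hom C h W L \<and> l 0 \<cdot> h = a \<and> l 1 \<cdot> h = b)" for h
      unfolding ob k_def by auto
    then show ?thesis using ex by simp
  qed
  then have "is_pullback C f g (l 0) (l 1)"
    using f g l eq by (auto simp: is_pullback_def in_hom_def)
  then show ?thesis by (rule that)
qed

lemma square_exists:
  assumes X: "X \<in> Ob C"
  shows "\<exists>P p q. is_square C X P p q"
proof -
  define Fo where "Fo = (\<lambda>i::nat. X)"
  define Fa where "Fa = (\<lambda>u::nat. Id C X)"
  have fn: "is_functor discrete_two C Fo Fa"
    using X unfolding is_functor_def discrete_two_def in_hom_def Fo_def Fa_def by auto
  have "finite (Ob discrete_two)" "finite (Ar discrete_two)"
    by (auto simp: discrete_two_def)
  then obtain L l where lim: "is_limit discrete_two C Fo Fa L l"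
    using finitely_complete category_discrete_two fn unfolding finitely_complete_def by blast
  have ob: "Ob discrete_two = {0, 1}" by (auto simp: discrete_two_def)
  have l: "in_hom C (l 0) L X" "in_hom C (l 1) L X"
    using lim[unfolded is_limit_def is_cone_def ob] by (simp_all add: Fo_def)
  have "\<exists>!h. in_hom C h W L \<and> l 0 \<cdot> h = a \<and> l 1 \<cdot> h = b"
    if a: "in_hom C a W X" and b: "in_hom C b W X" for W a b
  proof -
    define k where "k = (\<lambda>i::nat. if i = 0 then a else b)"
    have "is_cone discrete_two C Fo Fa W k"
      using a b
      unfolding is_cone_def k_def Fo_def Fa_def discrete_two_def in_hom_def by auto
    then have "\<exists>!h. in_hom C h W L \<and> (\<forall>i\<in>Ob discrete_two. l i \<cdot> h = k i)"
      using lim by (auto simp: is_limit_def)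
    then show ?thesis unfolding ob k_def by simp
  qed
  then show ?thesis using l unfolding is_square_def by blast
qed

lemma is_square_square:
  assumes "X \<in> Ob C"
  shows "is_square C X (square C X) (proj1 C X) (proj2 C X)"
proof -
  have "\<exists>c. case c of (P, p, q) \<Rightarrow> is_square C X P p q"
    using square_exists[OF assms] by simp
  then have "case square_cone C X of (P, p, q) \<Rightarrow> is_square C X P p q"
    unfolding square_cone_def by (rule someI_ex)
  then show ?thesis by (simp add: square_def proj1_def proj2_def case_prod_beta)
qed

lemma proj_simps [simp]:
  assumes "X \<in> Ob C"
  shows "proj1 C X \<in> Ar C" "Dom C (proj1 C X) = square C X" "Cod C (proj1 C X) = X"
    "proj2 C X \<in> Ar C" "Dom C (proj2 C X) = square C X" "Cod C (proj2 C X) = X"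
    "square C X \<in> Ob C"
  using is_square_square[OF assms] dom_Ob[of "proj1 C X"] by (auto simp: is_square_def in_hom_def)

lemma pairing_unique_existence:
  assumes "in_hom C a W X" "in_hom C b W X"
  shows "\<exists>!h. in_hom C h W (square C X) \<and> proj1 C X \<cdot> h = a \<and> proj2 C X \<cdot> h = b"
proof -
  have "X \<in> Ob C" using assms by (auto simp: in_hom_def)
  from is_square_square[OF this] show ?thesis using assms by (auto simp: is_square_def)
qed

lemma pairing:
  assumes "in_hom C a W X" "in_hom C b W X"
  shows "in_hom C (pairing C X a b) W (square C X)"
    "proj1 C X \<cdot> pairing C X a b = a" "proj2 C X \<cdot> pairing C X a b = b"
proof -
  have "Dom C a = W" using assms by (simp add: in_hom_def)
  then show "in_hom C (pairing C X a b) W (square C X)"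
    "proj1 C X \<cdot> pairing C X a b = a" "proj2 C X \<cdot> pairing C X a b = b"
    using theI'[OF pairing_unique_existence[OF assms]] unfolding pairing_def by auto
qed

lemma square_ext:
  assumes X: "X \<in> Ob C" and f: "in_hom C f W (square C X)" and g: "in_hom C g W (square C X)"
    and eq: "proj1 C X \<cdot> f = proj1 C X \<cdot> g" "proj2 C X \<cdot> f = proj2 C X \<cdot> g"
  shows "f = g"
proof -
  have "in_hom C (proj1 C X \<cdot> g) W X" "in_hom C (proj2 C X \<cdot> g) W X"
    using X g by (auto simp: in_hom_def)
  from pairing_unique_existence[OF this] show ?thesis using f g eq by auto
qed

text \<open>The coequalizer \<open>e\<close> of the kernel pair of \<open>f\<close> leaves a monic remainder \<open>m\<close>: if \<open>m u = m v\<close>, pull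
  \<open>e\<close> back along \<open>u\<close> and along \<open>v\<close>.  On the resulting domain, which is mapped to that of \<open>u\<close> and \<open>v\<close> by
  two regular epis, \<open>u\<close> and \<open>v\<close> lift through \<open>e\<close> to arrows identified by \<open>f\<close>, so by \<open>e\<close>.\<close>

lemma image_factorization:
  assumes f: "f \<in> Ar C"
  obtains e m where "is_regular_epi C e" "is_mono C m" "Cod C e = Dom C m" "m \<cdot> e = f"
    "Dom C e = Dom C f" "Cod C m = Cod C f"
proof -
  obtain p q where pb: "is_pullback C f f p q"
    using pullback_exists[of f "Dom C f" "Cod C f" f] f by (auto simp: in_hom_def)
  obtain e where e: "is_coequalizer C p q e" using kernel_pair_coequalizer[OF pb] by auto
  have re: "is_regular_epi C e" using e by (auto simp: is_regular_epi_def)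
  have ar: "p \<in> Ar C" "q \<in> Ar C" "Dom C q = Dom C p" "Cod C p = Dom C f" "Cod C q = Dom C f"
    "e \<in> Ar C" "Dom C e = Dom C f" and fpq: "f \<cdot> p = f \<cdot> q" and epq: "e \<cdot> p = e \<cdot> q"
    using pb e by (auto simp: is_pullback_def is_coequalizer_def in_hom_def)
  have "in_hom C f (Cod C p) (Cod C f)" using f ar by (simp add: in_hom_def)
  then obtain m where m: "in_hom C m (Cod C e) (Cod C f)" "m \<cdot> e = f"
    using e fpq unfolding is_coequalizer_def by blast
  have mar: "m \<in> Ar C" "Dom C m = Cod C e" "Cod C m = Cod C f" using m by (auto simp: in_hom_def)
  have "u = v" if u: "in_hom C u W (Cod C e)" and v: "in_hom C v W (Cod C e)" and uv: "m \<cdot> u = m \<cdot> v"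
    for W u v
  proof -
    have eh: "in_hom C e (Dom C e) (Cod C e)" using ar by (simp add: in_hom_def)
    obtain a1 e1 where pb1: "is_pullback C e u a1 e1" using pullback_exists[OF eh u] by auto
    have r1: "is_regular_epi C e1" using regular_epi_stable[OF pb1 re] .
    have ar1: "a1 \<in> Ar C" "e1 \<in> Ar C" "Dom C e1 = Dom C a1" "Cod C a1 = Dom C f" "Cod C e1 = W"
      and eq1: "e \<cdot> a1 = u \<cdot> e1"
      using pb1 ar u by (auto simp: is_pullback_def in_hom_def)
    have ve1: "in_hom C (v \<cdot> e1) (Dom C e1) (Cod C e)" using v ar1 by (auto simp: in_hom_def)
    obtain a2 e2 where pb2: "is_pullback C e (v \<cdot> e1) a2 e2" using pullback_exists[OF eh ve1] by auto
    have r2: "is_regular_epi C e2" using regular_epi_stable[OF pb2 re] .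
    have ar2: "a2 \<in> Ar C" "e2 \<in> Ar C" "Dom C e2 = Dom C a2" "Cod C a2 = Dom C f" "Cod C e2 = Dom C a1"
      and eq2: "e \<cdot> a2 = (v \<cdot> e1) \<cdot> e2"
      using pb2 ar ar1 ve1 by (auto simp: is_pullback_def in_hom_def)
    note uvh = u[unfolded in_hom_def] v[unfolded in_hom_def]
    have "f \<cdot> (a1 \<cdot> e2) = m \<cdot> ((e \<cdot> a1) \<cdot> e2)"
      unfolding m(2)[symmetric] using ar ar1 ar2 mar by simp
    also have "\<dots> = (m \<cdot> u) \<cdot> (e1 \<cdot> e2)"
      unfolding eq1 using ar ar1 ar2 mar uvh by simp
    also have "\<dots> = m \<cdot> (e \<cdot> a2)"
      unfolding eq2 uv using ar ar1 ar2 mar uvh by simp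
    also have "\<dots> = f \<cdot> a2"
      unfolding m(2)[symmetric] using ar ar1 ar2 mar by simp
    finally have feq: "f \<cdot> (a1 \<cdot> e2) = f \<cdot> a2" .
    have "in_hom C (a1 \<cdot> e2) (Dom C a2) (Dom C f)" "in_hom C a2 (Dom C a2) (Dom C f)"
      using ar1 ar2 by (auto simp: in_hom_def)
    then obtain h where h: "in_hom C h (Dom C a2) (Dom C p)" "p \<cdot> h = a1 \<cdot> e2" "q \<cdot> h = a2"
      using pb feq unfolding is_pullback_def by blast
    have "(u \<cdot> e1) \<cdot> e2 = e \<cdot> (a1 \<cdot> e2)"
      unfolding eq1[symmetric] using ar ar1 ar2 by simp
    also have "\<dots> = (e \<cdot> p) \<cdot> h" using ar h by (simp add: in_hom_def)
    also have "\<dots> = e \<cdot> a2" using ar h epq by (simp add: in_hom_def)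
    finally have ee: "(u \<cdot> e1) \<cdot> e2 = (v \<cdot> e1) \<cdot> e2" using eq2 by simp
    have "u \<cdot> e1 = v \<cdot> e1"
      by (rule regular_epi_epi[OF r2 _ _ ee, of "Cod C e"]) (use ar1 ar2 uvh in \<open>auto simp: in_hom_def\<close>)
    then show "u = v"
      by (rule regular_epi_epi[OF r1, of _ "Cod C e", rotated -1]) (use ar1 u v in auto)
  qed
  then have "is_mono C m" using mar by (intro is_monoI) simp_all
  then show ?thesis using that[OF re] ar mar m by auto
qed

section \<open>Covers\<close>

text \<open>These are the strong epis: the arrow \<open>d\<close> also satisfies \<open>d e = u\<close> because \<open>m\<close> is monic.  They are
  the same as regular epis in a regular category, but their closure under composition is
  immediate.\<close>

definition cover :: "'b \<Rightarrow> 'a \<Rightarrow> 'a \<Rightarrow> bool" where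
  "cover e V W \<longleftrightarrow> in_hom C e V W \<and>
     (\<forall>m u v. is_mono C m \<and> in_hom C u V (Dom C m) \<and> in_hom C v W (Cod C m) \<and> m \<cdot> u = v \<cdot> e \<longrightarrow>
        (\<exists>d. in_hom C d W (Dom C m) \<and> m \<cdot> d = v))"

lemma cover_in_hom: "cover e V W \<Longrightarrow> in_hom C e V W"
  by (simp add: cover_def)

lemma cover_lift:
  assumes "cover e V W" "is_mono C m" "in_hom C u V (Dom C m)" "in_hom C v W (Cod C m)" "m \<cdot> u = v \<cdot> e"
  obtains d where "in_hom C d W (Dom C m)" "m \<cdot> d = v"
  using assms unfolding cover_def by blast

lemma cover_id: "W \<in> Ob C \<Longrightarrow> cover (Id C W) W W"
  unfolding cover_def by (auto simp: in_hom_def)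

lemma cover_comp:
  assumes e: "cover e V W" and d: "cover d U V"
  shows "cover (e \<cdot> d) U W"
proof -
  note ar = cover_in_hom[OF e] cover_in_hom[OF d]
  have "\<exists>k. in_hom C k W (Dom C m) \<and> m \<cdot> k = v"
    if m: "is_mono C m" and u: "in_hom C u U (Dom C m)" and v: "in_hom C v W (Cod C m)"
      and eq: "m \<cdot> u = v \<cdot> (e \<cdot> d)" for m u v
  proof -
    have "m \<cdot> u = (v \<cdot> e) \<cdot> d" using eq v ar by (simp add: in_hom_def)
    moreover have "in_hom C (v \<cdot> e) V (Cod C m)" using v ar by (simp add: in_hom_def)
    ultimately obtain k where "in_hom C k V (Dom C m)" "m \<cdot> k = v \<cdot> e"
      using cover_lift[OF d m u] by blast
    then show ?thesis using cover_lift[OF e m _ v] by blast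
  qed
  then show ?thesis using ar unfolding cover_def by (auto simp: in_hom_def)
qed

lemma regular_epi_cover:
  assumes e: "is_regular_epi C e"
  shows "cover e (Dom C e) (Cod C e)"
proof -
  obtain a b where c: "is_coequalizer C a b e" using e by (auto simp: is_regular_epi_def)
  have ar: "a \<in> Ar C" "b \<in> Ar C" "e \<in> Ar C" "Dom C b = Dom C a" "Cod C b = Cod C a" "Dom C e = Cod C a"
    and eab: "e \<cdot> a = e \<cdot> b"
    using c by (auto simp: in_hom_def is_coequalizer_def)
  have "\<exists>d. in_hom C d (Cod C e) (Dom C m) \<and> m \<cdot> d = v"
    if m: "is_mono C m" and u: "in_hom C u (Dom C e) (Dom C m)" and v: "in_hom C v (Cod C e) (Cod C m)"
      and eq: "m \<cdot> u = v \<cdot> e" for m u v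
  proof -
    note har = u[unfolded in_hom_def] v[unfolded in_hom_def] is_mono_Ar[OF m]
    have "m \<cdot> (u \<cdot> a) = (v \<cdot> e) \<cdot> a" unfolding eq[symmetric] using har ar by simp
    also have "\<dots> = (v \<cdot> e) \<cdot> b" using har ar eab by simp
    also have "\<dots> = m \<cdot> (u \<cdot> b)" unfolding eq[symmetric] using har ar by simp
    finally have "m \<cdot> (u \<cdot> a) = m \<cdot> (u \<cdot> b)" .
    moreover have "in_hom C (u \<cdot> a) (Dom C a) (Dom C m)" "in_hom C (u \<cdot> b) (Dom C a) (Dom C m)"
      using har ar by (simp_all add: in_hom_def)
    ultimately have "u \<cdot> a = u \<cdot> b" using is_monoD[OF m] by blast
    moreover have "in_hom C u (Cod C a) (Dom C m)" using har ar by (simp add: in_hom_def)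
    ultimately obtain h where h: "in_hom C h (Cod C e) (Dom C m)" "h \<cdot> e = u"
      using c unfolding is_coequalizer_def by blast
    have "(m \<cdot> h) \<cdot> e = v \<cdot> e" using h har ar eq by (simp add: in_hom_def)
    moreover have "in_hom C (m \<cdot> h) (Cod C e) (Cod C m)" using h(1) har by (simp add: in_hom_def)
    ultimately have "m \<cdot> h = v" using regular_epi_epi[OF e _ v] by blast
    then show ?thesis using h(1) by blast
  qed
  moreover have "in_hom C e (Dom C e) (Cod C e)" using ar by (simp add: in_hom_def)
  ultimately show ?thesis unfolding cover_def by blast
qed

section \<open>Generalized elements of relations\<close>

text \<open>A mono \<open>m\<close> into \<open>X \<times> X\<close> is studied through the pairs of arrows into \<open>X\<close> whose pairing factors
  through it.  For a relation the choice of the representing mono does not matter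
  (\<open>related_iff_factors\<close>).\<close>

definition mono_into :: "'a \<Rightarrow> 'b \<Rightarrow> bool" where
  "mono_into X m \<longleftrightarrow> X \<in> Ob C \<and> is_mono C m \<and> Cod C m = square C X"

definition factors :: "'a \<Rightarrow> 'b \<Rightarrow> 'a \<Rightarrow> 'b \<Rightarrow> 'b \<Rightarrow> bool" where
  "factors X m W a b \<longleftrightarrow>
     (\<exists>h. in_hom C h W (Dom C m) \<and> proj1 C X \<cdot> (m \<cdot> h) = a \<and> proj2 C X \<cdot> (m \<cdot> h) = b)"

definition related :: "'a \<Rightarrow> 'b set \<Rightarrow> 'a \<Rightarrow> 'b \<Rightarrow> 'b \<Rightarrow> bool" where
  "related X R W a b \<longleftrightarrow> (\<exists>r\<in>R. factors X r W a b)"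

lemma mono_intoD:
  assumes "mono_into X m"
  shows "X \<in> Ob C" "is_mono C m" "m \<in> Ar C" "Cod C m = square C X"
  using assms is_mono_Ar by (auto simp: mono_into_def)

lemma factors_subobject_class:
  assumes m: "mono_into X m" and r: "r \<in> subobject_class C m"
  shows "mono_into X r" "factors X r W a b \<longleftrightarrow> factors X m W a b"
proof -
  note ar = mono_intoD[OF m]
  obtain k V where k: "r = m \<cdot> k" "is_iso C k V (Dom C m)" using r by (auto simp: subobject_class_def)
  then obtain l where l: "in_hom C k V (Dom C m)" "in_hom C l (Dom C m) V" "k \<cdot> l = Id C (Dom C m)"
    by (auto simp: is_iso_def)
  note lar = l(1,2)[unfolded in_hom_def]
  show "mono_into X r"
    unfolding mono_into_def k(1) using ar comp_mono[OF ar(2) iso_mono[OF k(2)]] lar by simp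
  have 1: "factors X m W a b" if h: "in_hom C h W V" "proj1 C X \<cdot> (r \<cdot> h) = a" "proj2 C X \<cdot> (r \<cdot> h) = b" for h
    unfolding factors_def
    by (rule exI[of _ "k \<cdot> h"]) (use h lar ar in \<open>simp add: in_hom_def k(1)\<close>)
  have "factors X r W a b"
    if h: "in_hom C h W (Dom C m)" "proj1 C X \<cdot> (m \<cdot> h) = a" "proj2 C X \<cdot> (m \<cdot> h) = b" for h
  proof -
    have "m \<cdot> (k \<cdot> (l \<cdot> h)) = m \<cdot> ((k \<cdot> l) \<cdot> h)" using h(1) lar ar by (simp add: in_hom_def)
    also have "\<dots> = m \<cdot> h" unfolding l(3) using h(1) lar ar by (simp add: in_hom_def)
    finally have "r \<cdot> (l \<cdot> h) = m \<cdot> h" unfolding k(1) using h(1) lar ar by (simp add: in_hom_def)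
    then show ?thesis
      unfolding factors_def
      by (intro exI[of _ "l \<cdot> h"]) (use h lar ar in \<open>simp add: in_hom_def k(1)\<close>)
  qed
  with 1 show "factors X r W a b \<longleftrightarrow> factors X m W a b"
    unfolding factors_def[of X m] factors_def[of X r] using lar k(1) ar by auto
qed

lemma factors_le:
  assumes m: "mono_into X m" and m': "mono_into X m'"
    and le: "\<And>W a b. factors X m W a b \<Longrightarrow> factors X m' W a b"
  obtains h where "in_hom C h (Dom C m) (Dom C m')" "m = m' \<cdot> h"
proof -
  note ar = mono_intoD[OF m] and ar' = mono_intoD[OF m']
  have "factors X m (Dom C m) (proj1 C X \<cdot> m) (proj2 C X \<cdot> m)"
    unfolding factors_def by (rule exI[of _ "Id C (Dom C m)"]) (use ar in \<open>simp add: in_hom_def\<close>)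
  then have "factors X m' (Dom C m) (proj1 C X \<cdot> m) (proj2 C X \<cdot> m)" by (rule le)
  then obtain h where h: "in_hom C h (Dom C m) (Dom C m')"
    "proj1 C X \<cdot> (m' \<cdot> h) = proj1 C X \<cdot> m" "proj2 C X \<cdot> (m' \<cdot> h) = proj2 C X \<cdot> m"
    by (auto simp: factors_def)
  have "m' \<cdot> h = m"
    by (rule square_ext[OF ar(1) _ _ h(2,3), of "Dom C m"]) (use h(1) ar ar' in \<open>simp_all add: in_hom_def\<close>)
  then show ?thesis using that h by blast
qed

text \<open>Each mono, as a generalized element of itself, is a generalized element of the other; the two
  comparison arrows are mutually inverse by monicity.\<close>

lemma factors_eq_imp_subobject_class:
  assumes m: "mono_into X m" and m': "mono_into X m'"
    and eq: "\<And>W a b. factors X m W a b \<longleftrightarrow> factors X m' W a b"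
  shows "m' \<in> subobject_class C m"
proof -
  note ar = mono_intoD[OF m] and ar' = mono_intoD[OF m']
  obtain k where k: "in_hom C k (Dom C m') (Dom C m)" "m' = m \<cdot> k"
    using factors_le[OF m' m] eq by blast
  obtain l where l: "in_hom C l (Dom C m) (Dom C m')" "m = m' \<cdot> l"
    using factors_le[OF m m'] eq by blast
  note kl = k(1)[unfolded in_hom_def] l(1)[unfolded in_hom_def]
  have "m \<cdot> (k \<cdot> l) = (m \<cdot> k) \<cdot> l" using kl ar by simp
  also have "\<dots> = m" using k(2) l(2) by simp
  also have "\<dots> = m \<cdot> Id C (Dom C m)" using ar by simp
  finally have 1: "k \<cdot> l = Id C (Dom C m)"
    by (rule is_monoD[OF ar(2), rotated -1]) (use kl ar in \<open>simp_all add: in_hom_def\<close>)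
  have "m' \<cdot> (l \<cdot> k) = (m' \<cdot> l) \<cdot> k" using kl ar' by simp
  also have "\<dots> = m'" using k(2) l(2) by simp
  also have "\<dots> = m' \<cdot> Id C (Dom C m')" using ar' by simp
  finally have 2: "l \<cdot> k = Id C (Dom C m')"
    by (rule is_monoD[OF ar'(2), rotated -1]) (use kl ar' in \<open>simp_all add: in_hom_def\<close>)
  have "is_iso C k (Dom C m') (Dom C m)" unfolding is_iso_def using 1 2 k(1) l(1) by blast
  then show ?thesis unfolding subobject_class_def using k(2) by blast
qed

lemma self_in_subobject_class:
  assumes "m \<in> Ar C"
  shows "m \<in> subobject_class C m"
proof -
  have "is_iso C (Id C (Dom C m)) (Dom C m) (Dom C m)"
    unfolding is_iso_def using assms by (auto simp: in_hom_def intro!: exI[of _ "Id C (Dom C m)"])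
  moreover have "m = m \<cdot> Id C (Dom C m)" using assms by simp
  ultimately show ?thesis unfolding subobject_class_def by blast
qed

lemma subobject_class_in_relations: "mono_into X m \<Longrightarrow> subobject_class C m \<in> relations C X"
  unfolding relations_def mono_into_def by blast

lemma related_subobject_class:
  assumes m: "mono_into X m"
  shows "related X (subobject_class C m) W a b \<longleftrightarrow> factors X m W a b"
  unfolding related_def
  using factors_subobject_class(2)[OF m] self_in_subobject_class[OF mono_intoD(3)[OF m]] by blast

lemma relationsE:
  assumes "R \<in> relations C X" "X \<in> Ob C"
  obtains m where "mono_into X m" "R = subobject_class C m" "m \<in> R"
    "\<And>W a b. related X R W a b \<longleftrightarrow> factors X m W a b"
proof -
  obtain m where m: "is_mono C m" "Cod C m = square C X" "R = subobject_class C m"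
    using assms by (auto simp: relations_def)
  then have mi: "mono_into X m" using assms(2) by (simp add: mono_into_def)
  show ?thesis
    using that[OF mi m(3)] m(3) self_in_subobject_class[OF is_mono_Ar[OF m(1)]] related_subobject_class[OF mi] by simp
qed

lemma related_iff_factors:
  assumes "R \<in> relations C X" "X \<in> Ob C" "r \<in> R"
  shows "mono_into X r" "related X R W a b \<longleftrightarrow> factors X r W a b"
  using relationsE[OF assms(1,2)] factors_subobject_class assms(3) by metis+

lemma related_in_hom:
  assumes "R \<in> relations C X" "X \<in> Ob C" "related X R W a b"
  shows "in_hom C a W X" "in_hom C b W X"
proof -
  obtain m where m: "mono_into X m" and "\<And>W a b. related X R W a b \<longleftrightarrow> factors X m W a b"
    using relationsE[OF assms(1,2)] by metis
  then have "factors X m W a b" using assms(3) by simp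
  then show "in_hom C a W X" "in_hom C b W X"
    using mono_intoD[OF m] by (auto simp: factors_def in_hom_def)
qed

lemma related_comp:
  assumes "R \<in> relations C X" "X \<in> Ob C" "related X R W a b" "in_hom C t V W"
  shows "related X R V (a \<cdot> t) (b \<cdot> t)"
proof -
  obtain m where m: "mono_into X m" and eq: "\<And>W a b. related X R W a b \<longleftrightarrow> factors X m W a b"
    using relationsE[OF assms(1,2)] by metis
  then obtain h where "in_hom C h W (Dom C m)" "proj1 C X \<cdot> (m \<cdot> h) = a" "proj2 C X \<cdot> (m \<cdot> h) = b"
    using assms(3) by (auto simp: factors_def)
  then have "factors X m V (a \<cdot> t) (b \<cdot> t)"
    unfolding factors_def
    by (intro exI[of _ "h \<cdot> t"]) (use assms(4) mono_intoD[OF m] in \<open>auto simp: in_hom_def\<close>)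
  then show ?thesis by (simp add: eq)
qed

text \<open>The pairing of \<open>a\<close> and \<open>b\<close> composed with \<open>e\<close> factors through the mono \<open>m\<close>, so orthogonality of the
  cover \<open>e\<close> to \<open>m\<close> lifts the pairing itself.\<close>

lemma factors_descent:
  assumes m: "mono_into X m" and e: "cover e V W"
    and a: "in_hom C a W X" and b: "in_hom C b W X"
    and f: "factors X m V (a \<cdot> e) (b \<cdot> e)"
  shows "factors X m W a b"
proof -
  note ar = mono_intoD[OF m] and ear = cover_in_hom[OF e, unfolded in_hom_def]
  note p = pairing[OF a b]
  obtain h where h: "in_hom C h V (Dom C m)" "proj1 C X \<cdot> (m \<cdot> h) = a \<cdot> e" "proj2 C X \<cdot> (m \<cdot> h) = b \<cdot> e"
    using f by (auto simp: factors_def)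
  note par = p(1)[unfolded in_hom_def]
  have pe: "proj1 C X \<cdot> (pairing C X a b \<cdot> e) = a \<cdot> e" "proj2 C X \<cdot> (pairing C X a b \<cdot> e) = b \<cdot> e"
    using comp_assoc_arrows[of e "pairing C X a b" "proj1 C X"]
      comp_assoc_arrows[of e "pairing C X a b" "proj2 C X"] ar ear par p(2,3) by simp_all
  have "m \<cdot> h = pairing C X a b \<cdot> e"
    by (rule square_ext[OF ar(1), of _ V]) (use h ar ear par pe in \<open>simp_all add: in_hom_def\<close>)
  moreover have "in_hom C (pairing C X a b) W (Cod C m)" using p(1) ar by simp
  ultimately obtain d where "in_hom C d W (Dom C m)" "m \<cdot> d = pairing C X a b"
    using cover_lift[OF e ar(2) h(1)] by blast
  then show ?thesis unfolding factors_def using p by auto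
qed

lemma related_descent:
  assumes "R \<in> relations C X" "cover e V W" "in_hom C a W X" "in_hom C b W X"
    and "related X R V (a \<cdot> e) (b \<cdot> e)"
  shows "related X R W a b"
proof -
  have "X \<in> Ob C" using assms(3) by (auto simp: in_hom_def)
  then show ?thesis using factors_descent assms relationsE by metis
qed

lemma rel_le_iff_related:
  assumes R: "R \<in> relations C X" and S: "S \<in> relations C X" and X: "X \<in> Ob C"
  shows "rel_le C R S \<longleftrightarrow> (\<forall>W a b. related X R W a b \<longrightarrow> related X S W a b)"
proof
  assume "rel_le C R S"
  then obtain r s h where rs: "r \<in> R" "s \<in> S" and h: "in_hom C h (Dom C r) (Dom C s)" "r = s \<cdot> h"
    by (auto simp: rel_le_def)
  note s = mono_intoD[OF related_iff_factors(1)[OF S X rs(2)]]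
  note iff = related_iff_factors(2)[OF R X rs(1)] related_iff_factors(2)[OF S X rs(2)]
  show "\<forall>W a b. related X R W a b \<longrightarrow> related X S W a b"
    unfolding iff
  proof (intro allI impI)
    fix W a b assume "factors X r W a b"
    then obtain k where k: "in_hom C k W (Dom C r)" "proj1 C X \<cdot> (r \<cdot> k) = a" "proj2 C X \<cdot> (r \<cdot> k) = b"
      by (auto simp: factors_def)
    have "r \<cdot> k = (s \<cdot> h) \<cdot> k" by (simp only: h(2))
    also have "\<dots> = s \<cdot> (h \<cdot> k)" using k(1) h(1) s by (simp add: in_hom_def)
    finally have "r \<cdot> k = s \<cdot> (h \<cdot> k)" .
    then show "factors X s W a b"
      unfolding factors_def using k comp_in_hom[OF k(1) h(1)] by (intro exI[of _ "h \<cdot> k"]) simp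
  qed
next
  assume le: "\<forall>W a b. related X R W a b \<longrightarrow> related X S W a b"
  obtain r where r: "mono_into X r" "r \<in> R" "\<And>W a b. related X R W a b \<longleftrightarrow> factors X r W a b"
    using relationsE[OF R X] by metis
  obtain s where s: "mono_into X s" "s \<in> S" "\<And>W a b. related X S W a b \<longleftrightarrow> factors X s W a b"
    using relationsE[OF S X] by metis
  show "rel_le C R S"
    using factors_le[OF r(1) s(1)] le r s unfolding rel_le_def by metis
qed

lemma relation_eqI:
  assumes R: "R \<in> relations C X" and S: "S \<in> relations C X" and X: "X \<in> Ob C"
    and eq: "\<And>W a b. related X R W a b \<longleftrightarrow> related X S W a b"
  shows "R = S"
proof -
  have "R \<subseteq> S" if R: "R \<in> relations C X" and S: "S \<in> relations C X"
    and eq: "\<And>W a b. related X R W a b \<longleftrightarrow> related X S W a b" for R S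
  proof
    fix r assume r: "r \<in> R"
    obtain s where s: "mono_into X s" "S = subobject_class C s" "\<And>W a b. related X S W a b \<longleftrightarrow> factors X s W a b"
      using relationsE[OF S X] by metis
    show "r \<in> S"
      unfolding s(2) using related_iff_factors[OF R X r] s eq by (intro factors_eq_imp_subobject_class) auto
  qed
  then show ?thesis using assms by blast
qed

section \<open>The diagonal, opposite and composite relations\<close>

lemma
  assumes X: "X \<in> Ob C"
  shows diagonal_in_relations: "diagonal C X \<in> relations C X"
    and related_diagonal: "related X (diagonal C X) W a b \<longleftrightarrow> in_hom C a W X \<and> b = a"
proof -
  have idX: "in_hom C (Id C X) X X" using X by (rule id_in_hom)
  define d where "d = pairing C X (Id C X) (Id C X)"
  note d = pairing[OF idX idX, folded d_def]
  note dar = d(1)[unfolded in_hom_def]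
  have proj: "proj1 C X \<cdot> (d \<cdot> h) = h" "proj2 C X \<cdot> (d \<cdot> h) = h" if "in_hom C h W X" for h W
    using comp_assoc_arrows[of h d "proj1 C X"] comp_assoc_arrows[of h d "proj2 C X"] X dar d(2,3) that
    by (simp_all add: in_hom_def)
  have "is_mono C d"
  proof (rule is_monoI)
    fix W f g
    assume "in_hom C f W (Dom C d)" "in_hom C g W (Dom C d)" and eq: "d \<cdot> f = d \<cdot> g"
    then have fg: "in_hom C f W X" "in_hom C g W X" using dar by simp_all
    have "f = proj1 C X \<cdot> (d \<cdot> f)" using proj(1)[OF fg(1)] by simp
    also have "\<dots> = g" unfolding eq by (rule proj(1)[OF fg(2)])
    finally show "f = g" .
  qed (use dar in simp)
  then have m: "mono_into X d" using X dar by (simp add: mono_into_def)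
  show "diagonal C X \<in> relations C X"
    using subobject_class_in_relations[OF m] by (simp add: diagonal_def d_def)
  have "factors X d W a b \<longleftrightarrow> in_hom C a W X \<and> b = a"
    unfolding factors_def using proj dar by auto
  then show "related X (diagonal C X) W a b \<longleftrightarrow> in_hom C a W X \<and> b = a"
    using related_subobject_class[OF m] by (simp add: diagonal_def d_def)
qed

lemma
  assumes R: "R \<in> relations C X" and X: "X \<in> Ob C"
  shows rel_op_in_relations: "rel_op C X R \<in> relations C X"
    and related_rel_op: "related X (rel_op C X R) W a b \<longleftrightarrow> related X R W b a"
proof -
  obtain m where m: "mono_into X m" and Rm: "R = subobject_class C m" and
    eq: "\<And>W a b. related X R W a b \<longleftrightarrow> factors X m W a b"
    using relationsE[OF R X] by metis
  define swap where "swap r = pairing C X (proj2 C X \<cdot> r) (proj1 C X \<cdot> r)" for r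
  have swap: "in_hom C (swap r) W (square C X)" "proj1 C X \<cdot> swap r = proj2 C X \<cdot> r"
      "proj2 C X \<cdot> swap r = proj1 C X \<cdot> r" if "in_hom C r W (square C X)" for r W
    unfolding swap_def by (rule pairing[of _ W]; use X that in \<open>simp add: in_hom_def\<close>)+
  have swap_comp: "swap (r \<cdot> h) = swap r \<cdot> h"
    if r: "in_hom C r W (square C X)" and h: "in_hom C h V W" for r W h V
  proof (rule square_ext[OF X, of _ V])
    note s = swap[OF r] swap[OF comp_in_hom[OF h r]]
    show "in_hom C (swap (r \<cdot> h)) V (square C X)" by fact
    show "in_hom C (swap r \<cdot> h) V (square C X)" using s(1) h by (rule comp_in_hom[rotated])
    have "proj1 C X \<cdot> (swap r \<cdot> h) = (proj1 C X \<cdot> swap r) \<cdot> h"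
      using X s(1) h by (simp add: in_hom_def)
    then show "proj1 C X \<cdot> swap (r \<cdot> h) = proj1 C X \<cdot> (swap r \<cdot> h)"
      using s X h r by (simp add: in_hom_def)
    have "proj2 C X \<cdot> (swap r \<cdot> h) = (proj2 C X \<cdot> swap r) \<cdot> h"
      using X s(1) h by (simp add: in_hom_def)
    then show "proj2 C X \<cdot> swap (r \<cdot> h) = proj2 C X \<cdot> (swap r \<cdot> h)"
      using s X h r by (simp add: in_hom_def)
  qed
  note ar = mono_intoD[OF m]
  have mh: "in_hom C m (Dom C m) (square C X)" using ar by (simp add: in_hom_def)
  note sm = swap[OF mh]
  have "rel_op C X R = {swap r | r. r \<in> R}" by (simp add: rel_op_def swap_def)
  also have "\<dots> = subobject_class C (swap m)"
  proof -
    have "swap (m \<cdot> h) = swap m \<cdot> h" if "is_iso C h W (Dom C m)" for h W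
      using that swap_comp[OF mh] by (auto simp: is_iso_def)
    moreover have "Dom C (swap m) = Dom C m" using sm by (simp add: in_hom_def)
    ultimately show ?thesis unfolding Rm subobject_class_def by auto metis+
  qed
  finally have op: "rel_op C X R = subobject_class C (swap m)" .
  have "f = g" if f: "in_hom C f W (Dom C m)" and g: "in_hom C g W (Dom C m)"
    and fg: "swap m \<cdot> f = swap m \<cdot> g" for W f g
  proof -
    have eq: "swap (m \<cdot> f) = swap (m \<cdot> g)" using swap_comp[OF mh] f g fg by simp
    have "m \<cdot> f = m \<cdot> g"
      using swap(2,3)[OF comp_in_hom[OF f mh]] swap(2,3)[OF comp_in_hom[OF g mh]] eq
      by (intro square_ext[OF X comp_in_hom[OF f mh] comp_in_hom[OF g mh]]) simp_all
    then show ?thesis using is_monoD[OF ar(2) f g] by simp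
  qed
  then have "is_mono C (swap m)" using sm by (intro is_monoI) (simp_all add: in_hom_def)
  then have ms: "mono_into X (swap m)" using X sm by (simp add: mono_into_def in_hom_def)
  show "rel_op C X R \<in> relations C X" unfolding op by (rule subobject_class_in_relations[OF ms])
  have "Dom C (swap m) = Dom C m" using sm by (simp add: in_hom_def)
  moreover have "proj1 C X \<cdot> (swap m \<cdot> h) = proj2 C X \<cdot> (m \<cdot> h)" "proj2 C X \<cdot> (swap m \<cdot> h) = proj1 C X \<cdot> (m \<cdot> h)"
    if h: "in_hom C h W (Dom C m)" for h
    using swap(2,3)[OF comp_in_hom[OF h mh]] swap_comp[OF mh h] by simp_all
  ultimately have "factors X (swap m) W a b \<longleftrightarrow> factors X m W b a"
    unfolding factors_def by auto
  then show "related X (rel_op C X R) W a b \<longleftrightarrow> related X R W b a"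
    by (simp add: op related_subobject_class[OF ms] eq)
qed

lemma pullbackD:
  assumes "is_pullback C f g p q"
  shows "f \<in> Ar C" "g \<in> Ar C" "Cod C f = Cod C g" "p \<in> Ar C" "q \<in> Ar C" "Dom C q = Dom C p"
    "Cod C p = Dom C f" "Cod C q = Dom C g" "f \<cdot> p = g \<cdot> q"
  using assms by (auto simp: is_pullback_def in_hom_def)

lemma pullback_lift:
  assumes "is_pullback C f g p q" "in_hom C a W (Dom C f)" "in_hom C b W (Dom C g)" "f \<cdot> a = g \<cdot> b"
  obtains h where "in_hom C h W (Dom C p)" "p \<cdot> h = a" "q \<cdot> h = b"
  using assms unfolding is_pullback_def by blast

text \<open>An arrow into the image \<open>m\<close> lifts to the pullback of \<open>r\<close> and \<open>s\<close> only after pulling back the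
  regular epi \<open>e\<close> along it; that pullback is the cover on which the middle element \<open>b\<close> lives.
  Conversely a middle element on a cover gives an arrow into the pullback, and the result descends.\<close>

lemma factors_composite:
  assumes r: "mono_into X r" and s: "mono_into X s"
    and pb: "is_pullback C (proj2 C X \<cdot> r) (proj1 C X \<cdot> s) p q"
    and e: "is_regular_epi C e" and m: "is_mono C m" and em: "Cod C e = Dom C m"
    and me: "m \<cdot> e = pairing C X ((proj1 C X \<cdot> r) \<cdot> p) ((proj2 C X \<cdot> s) \<cdot> q)"
  shows "mono_into X m"
    and "factors X m W a c \<longleftrightarrow> in_hom C a W X \<and> in_hom C c W X \<and>
      (\<exists>V d b. cover d V W \<and> factors X r V (a \<cdot> d) b \<and> factors X s V b (c \<cdot> d))"
proof -
  note rar = mono_intoD[OF r] and sar = mono_intoD[OF s] and mar = is_mono_Ar[OF m] and ear = regular_epi_Ar[OF e]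
  note X = rar(1)
  have pq: "p \<in> Ar C" "q \<in> Ar C" "Dom C q = Dom C p" "Cod C p = Dom C r" "Cod C q = Dom C s"
    using pullbackD[OF pb] rar sar by simp_all
  have "(proj2 C X \<cdot> r) \<cdot> p = (proj1 C X \<cdot> s) \<cdot> q" using pullbackD(9)[OF pb] .
  then have pq_eq: "proj2 C X \<cdot> (r \<cdot> p) = proj1 C X \<cdot> (s \<cdot> q)" using pq rar sar by simp
  have hom: "in_hom C ((proj1 C X \<cdot> r) \<cdot> p) (Dom C p) X" "in_hom C ((proj2 C X \<cdot> s) \<cdot> q) (Dom C p) X"
    using pq rar sar by (simp_all add: in_hom_def)
  note pr = pairing[OF hom, folded me]
  have "in_hom C (m \<cdot> e) (Dom C p) (square C X)" by (rule pr(1))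
  then have cm: "Cod C m = square C X" and de: "Dom C e = Dom C p"
    using mar ear em by (simp_all add: in_hom_def)
  show mi: "mono_into X m" using X m cm by (simp add: mono_into_def)
  have pr1: "proj1 C X \<cdot> (m \<cdot> (e \<cdot> t)) = proj1 C X \<cdot> (r \<cdot> (p \<cdot> t))"
    and pr2: "proj2 C X \<cdot> (m \<cdot> (e \<cdot> t)) = proj2 C X \<cdot> (s \<cdot> (q \<cdot> t))"
    and pqt: "proj2 C X \<cdot> (r \<cdot> (p \<cdot> t)) = proj1 C X \<cdot> (s \<cdot> (q \<cdot> t))"
    if t: "in_hom C t V (Dom C p)" for t V
  proof -
    note ar = rar sar pq mar ear em de cm t[unfolded in_hom_def]
    have "proj1 C X \<cdot> (m \<cdot> (e \<cdot> t)) = (proj1 C X \<cdot> (m \<cdot> e)) \<cdot> t" using ar by simp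
    also have "\<dots> = proj1 C X \<cdot> (r \<cdot> (p \<cdot> t))" unfolding pr using ar by simp
    finally show "proj1 C X \<cdot> (m \<cdot> (e \<cdot> t)) = proj1 C X \<cdot> (r \<cdot> (p \<cdot> t))" .
    have "proj2 C X \<cdot> (m \<cdot> (e \<cdot> t)) = (proj2 C X \<cdot> (m \<cdot> e)) \<cdot> t" using ar by simp
    also have "\<dots> = proj2 C X \<cdot> (s \<cdot> (q \<cdot> t))" unfolding pr using ar by simp
    finally show "proj2 C X \<cdot> (m \<cdot> (e \<cdot> t)) = proj2 C X \<cdot> (s \<cdot> (q \<cdot> t))" .
    have "proj2 C X \<cdot> (r \<cdot> (p \<cdot> t)) = (proj2 C X \<cdot> (r \<cdot> p)) \<cdot> t" using ar by simp
    also have "\<dots> = proj1 C X \<cdot> (s \<cdot> (q \<cdot> t))" unfolding pq_eq using ar by simp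
    finally show "proj2 C X \<cdot> (r \<cdot> (p \<cdot> t)) = proj1 C X \<cdot> (s \<cdot> (q \<cdot> t))" .
  qed
  show "factors X m W a c \<longleftrightarrow> in_hom C a W X \<and> in_hom C c W X \<and>
      (\<exists>V d b. cover d V W \<and> factors X r V (a \<cdot> d) b \<and> factors X s V b (c \<cdot> d))"
    (is "_ \<longleftrightarrow> ?R")
  proof
    assume "factors X m W a c"
    then obtain h where h: "in_hom C h W (Dom C m)" "proj1 C X \<cdot> (m \<cdot> h) = a" "proj2 C X \<cdot> (m \<cdot> h) = c"
      by (auto simp: factors_def)
    note har = h(1)[unfolded in_hom_def]
    have eh: "in_hom C e (Dom C p) (Dom C m)" using ear em de by (simp add: in_hom_def)
    obtain t d where pb': "is_pullback C e h t d" using pullback_exists[OF eh h(1)] by blast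
    note tar = pullbackD[OF pb']
    have d: "cover d (Dom C t) W"
      using regular_epi_cover[OF regular_epi_stable[OF pb' e]] tar har by simp
    have t: "in_hom C t (Dom C t) (Dom C p)" using tar de by (simp add: in_hom_def)
    have "a \<cdot> d = proj1 C X \<cdot> (m \<cdot> (h \<cdot> d))"
      unfolding h(2)[symmetric] using tar(1-8) har mar cm X by simp
    then have ad: "a \<cdot> d = proj1 C X \<cdot> (r \<cdot> (p \<cdot> t))" using tar(9) pr1[OF t] by simp
    have "c \<cdot> d = proj2 C X \<cdot> (m \<cdot> (h \<cdot> d))"
      unfolding h(3)[symmetric] using tar(1-8) har mar cm X by simp
    then have cd: "c \<cdot> d = proj2 C X \<cdot> (s \<cdot> (q \<cdot> t))" using tar(9) pr2[OF t] by simp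
    have pt: "in_hom C (p \<cdot> t) (Dom C t) (Dom C r)" "in_hom C (q \<cdot> t) (Dom C t) (Dom C s)"
      using t pq by (simp_all add: in_hom_def)
    have "factors X r (Dom C t) (a \<cdot> d) (proj2 C X \<cdot> (r \<cdot> (p \<cdot> t)))"
      unfolding factors_def ad using pt(1) by blast
    moreover have "factors X s (Dom C t) (proj2 C X \<cdot> (r \<cdot> (p \<cdot> t))) (c \<cdot> d)"
      unfolding factors_def cd using pt(2) pqt[OF t, symmetric] by blast
    moreover have "in_hom C a W X" "in_hom C c W X"
      using h(2,3) har mar cm X by (auto simp: in_hom_def)
    ultimately show ?R using d by blast
  next
    assume ?R
    then obtain V d b where a: "in_hom C a W X" and c: "in_hom C c W X" and d: "cover d V W"
      and fr: "factors X r V (a \<cdot> d) b" and fs: "factors X s V b (c \<cdot> d)" by blast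
    obtain h where h: "in_hom C h V (Dom C r)" "proj1 C X \<cdot> (r \<cdot> h) = a \<cdot> d" "proj2 C X \<cdot> (r \<cdot> h) = b"
      using fr by (auto simp: factors_def)
    obtain k where k: "in_hom C k V (Dom C s)" "proj1 C X \<cdot> (s \<cdot> k) = b" "proj2 C X \<cdot> (s \<cdot> k) = c \<cdot> d"
      using fs by (auto simp: factors_def)
    have "(proj2 C X \<cdot> r) \<cdot> h = (proj1 C X \<cdot> s) \<cdot> k"
      using h(1,3) k(1,2) rar sar by (simp add: in_hom_def)
    moreover have "in_hom C h V (Dom C (proj2 C X \<cdot> r))" "in_hom C k V (Dom C (proj1 C X \<cdot> s))"
      using h(1) k(1) rar sar by simp_all
    ultimately obtain t where t: "in_hom C t V (Dom C p)" "p \<cdot> t = h" "q \<cdot> t = k"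
      using pullback_lift[OF pb] by blast
    have "in_hom C (e \<cdot> t) V (Dom C m)" using t(1) ear em de by (simp add: in_hom_def)
    then have "factors X m V (a \<cdot> d) (c \<cdot> d)"
      unfolding factors_def using pr1[OF t(1)] pr2[OF t(1)] t(2,3) h(2) k(3) by auto
    then show "factors X m W a c" by (rule factors_descent[OF mi d a c])
  qed
qed

lemma
  assumes R: "R \<in> relations C X" and S: "S \<in> relations C X" and X: "X \<in> Ob C"
  shows rel_comp_in_relations: "rel_comp C X S R \<in> relations C X"
    and related_rel_comp: "related X (rel_comp C X S R) W a c \<longleftrightarrow> in_hom C a W X \<and> in_hom C c W X \<and>
      (\<exists>V d b. cover d V W \<and> related X R V (a \<cdot> d) b \<and> related X S V b (c \<cdot> d))"
proof -
  \<comment> \<open>all monos admitted by the definition have the same generalized elements, so they form a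
    single class\<close>
  define composite where "composite r s p q e m \<longleftrightarrow>
    is_pullback C (proj2 C X \<cdot> r) (proj1 C X \<cdot> s) p q \<and> is_regular_epi C e \<and> is_mono C m \<and>
    Cod C e = Dom C m \<and> m \<cdot> e = pairing C X ((proj1 C X \<cdot> r) \<cdot> p) ((proj2 C X \<cdot> s) \<cdot> q)" for r s p q e m
  have mem: "m \<in> rel_comp C X S R \<longleftrightarrow> (\<exists>r\<in>R. \<exists>s\<in>S. \<exists>p q e. composite r s p q e m)" for m
    unfolding rel_comp_def composite_def by blast
  have elements: "mono_into X m" "factors X m W a c \<longleftrightarrow> in_hom C a W X \<and> in_hom C c W X \<and>
      (\<exists>V d b. cover d V W \<and> related X R V (a \<cdot> d) b \<and> related X S V b (c \<cdot> d))"
    if r: "r \<in> R" and s: "s \<in> S" and c: "composite r s p q e m" for r s p q e m W a c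
  proof -
    note rf = related_iff_factors[OF R X r] and sf = related_iff_factors[OF S X s]
    have c': "is_pullback C (proj2 C X \<cdot> r) (proj1 C X \<cdot> s) p q" "is_regular_epi C e" "is_mono C m"
      "Cod C e = Dom C m" "m \<cdot> e = pairing C X ((proj1 C X \<cdot> r) \<cdot> p) ((proj2 C X \<cdot> s) \<cdot> q)"
      using c unfolding composite_def by simp_all
    show "mono_into X m" "factors X m W a c \<longleftrightarrow> in_hom C a W X \<and> in_hom C c W X \<and>
      (\<exists>V d b. cover d V W \<and> related X R V (a \<cdot> d) b \<and> related X S V b (c \<cdot> d))"
      unfolding rf(2) sf(2) by (rule factors_composite[OF rf(1) sf(1) c'])+
  qed
  obtain r where r: "mono_into X r" "r \<in> R" using relationsE[OF R X] by metis
  obtain s where s: "mono_into X s" "s \<in> S" using relationsE[OF S X] by metis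
  note ar = mono_intoD[OF r(1)] mono_intoD[OF s(1)]
  have rs: "in_hom C (proj2 C X \<cdot> r) (Dom C r) X" "in_hom C (proj1 C X \<cdot> s) (Dom C s) X"
    using ar by (simp_all add: in_hom_def)
  obtain p q where pb: "is_pullback C (proj2 C X \<cdot> r) (proj1 C X \<cdot> s) p q"
    using pullback_exists[OF rs] by blast
  note pq = pullbackD[OF pb]
  have "in_hom C ((proj1 C X \<cdot> r) \<cdot> p) (Dom C p) X" "in_hom C ((proj2 C X \<cdot> s) \<cdot> q) (Dom C p) X"
    using pq(1-8) ar by (simp_all add: in_hom_def)
  from pairing(1)[OF this] obtain e m where em: "is_regular_epi C e" "is_mono C m" "Cod C e = Dom C m"
    "m \<cdot> e = pairing C X ((proj1 C X \<cdot> r) \<cdot> p) ((proj2 C X \<cdot> s) \<cdot> q)"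
    using image_factorization unfolding in_hom_def by metis
  have c: "composite r s p q e m" unfolding composite_def using pb em by blast
  note m = elements[OF r(2) s(2) c]
  note mar = mono_intoD[OF m(1)]
  have "rel_comp C X S R = subobject_class C m"
  proof (intro equalityI subsetI)
    fix m' assume "m' \<in> rel_comp C X S R"
    then obtain r' s' p' q' e' where 1: "r' \<in> R" "s' \<in> S" "composite r' s' p' q' e' m'" using mem by blast
    show "m' \<in> subobject_class C m"
      using factors_eq_imp_subobject_class[OF m(1) elements(1)[OF 1]] m(2) elements(2)[OF 1] by metis
  next
    fix m' assume "m' \<in> subobject_class C m"
    then obtain h W where h: "m' = m \<cdot> h" "is_iso C h W (Dom C m)" by (auto simp: subobject_class_def)
    then obtain k where k: "in_hom C h W (Dom C m)" "in_hom C k (Dom C m) W"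
      "k \<cdot> h = Id C W" "h \<cdot> k = Id C (Dom C m)" by (auto simp: is_iso_def)
    note kar = k(1,2)[unfolded in_hom_def] and ear = regular_epi_Ar[OF em(1)]
    have "is_iso C k (Cod C e) W" unfolding is_iso_def em(3) using k by blast
    then have "is_regular_epi C (k \<cdot> e)" by (rule iso_regular_epi[OF em(1)])
    moreover have "m' \<cdot> (k \<cdot> e) = m \<cdot> e"
    proof -
      have "m' \<cdot> (k \<cdot> e) = m \<cdot> ((h \<cdot> k) \<cdot> e)" unfolding h(1) using kar ear em(3) mar by simp
      then show ?thesis using k(4) ear em(3) by simp
    qed
    moreover have "is_mono C m'" unfolding h(1) using comp_mono[OF em(2) iso_mono[OF h(2)]] kar by simp
    moreover have "Cod C (k \<cdot> e) = Dom C m'" unfolding h(1) using kar ear em(3) mar by simp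
    ultimately have "composite r s p q (k \<cdot> e) m'" unfolding composite_def using pb em(4) by simp
    then show "m' \<in> rel_comp C X S R" using mem r(2) s(2) by blast
  qed
  then show "rel_comp C X S R \<in> relations C X"
    "related X (rel_comp C X S R) W a c \<longleftrightarrow> in_hom C a W X \<and> in_hom C c W X \<and>
      (\<exists>V d b. cover d V W \<and> related X R V (a \<cdot> d) b \<and> related X S V b (c \<cdot> d))"
    using subobject_class_in_relations[OF m(1)] related_subobject_class[OF m(1)] m(2) by simp_all
qed

lemma rel_compI:
  assumes R: "R \<in> relations C X" and S: "S \<in> relations C X" and X: "X \<in> Ob C"
    and ab: "related X R W a b" and bc: "related X S W b c"
  shows "related X (rel_comp C X S R) W a c"
proof -
  note hom = related_in_hom[OF R X ab] related_in_hom[OF S X bc]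
  then have W: "W \<in> Ob C" by (auto simp: in_hom_def)
  have "a \<cdot> Id C W = a" "c \<cdot> Id C W = c" using hom by (simp_all add: in_hom_def)
  then have "related X R W (a \<cdot> Id C W) b" "related X S W b (c \<cdot> Id C W)" using ab bc by simp_all
  then show ?thesis unfolding related_rel_comp[OF R S X] using cover_id[OF W] hom by blast
qed

lemma rel_compE:
  assumes "R \<in> relations C X" "S \<in> relations C X" "X \<in> Ob C"
    and "related X (rel_comp C X S R) W a c"
  obtains V d b where "cover d V W" "related X R V (a \<cdot> d) b" "related X S V b (c \<cdot> d)"
  using assms related_rel_comp[OF assms(1-3)] by blast

lemma equivalence_relation_iff:
  assumes X: "X \<in> Ob C"
  shows "equivalence_relation C X R \<longleftrightarrow> R \<in> relations C X \<and>
    (\<forall>W a. in_hom C a W X \<longrightarrow> related X R W a a) \<and>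
    (\<forall>W a b. related X R W a b \<longrightarrow> related X R W b a) \<and>
    (\<forall>W a b c. related X R W a b \<longrightarrow> related X R W b c \<longrightarrow> related X R W a c)"
proof (cases "R \<in> relations C X")
  case R: True
  note op = rel_op_in_relations[OF R X] and cp = rel_comp_in_relations[OF R R X]
  have "rel_le C (diagonal C X) R \<longleftrightarrow> (\<forall>W a. in_hom C a W X \<longrightarrow> related X R W a a)"
    unfolding rel_le_iff_related[OF diagonal_in_relations[OF X] R X] related_diagonal[OF X] by blast
  moreover have "rel_le C (rel_op C X R) R \<longleftrightarrow> (\<forall>W a b. related X R W a b \<longrightarrow> related X R W b a)"
    unfolding rel_le_iff_related[OF op R X] related_rel_op[OF R X] by blast
  moreover have "rel_le C (rel_comp C X R R) R \<longleftrightarrow>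
    (\<forall>W a b c. related X R W a b \<longrightarrow> related X R W b c \<longrightarrow> related X R W a c)"
    unfolding rel_le_iff_related[OF cp R X]
  proof (intro iffI allI impI)
    fix W a b c
    assume "\<forall>W a b. related X (rel_comp C X R R) W a b \<longrightarrow> related X R W a b"
      "related X R W a b" "related X R W b c"
    then show "related X R W a c" using rel_compI[OF R R X] by blast
  next
    fix W a c
    assume trans: "\<forall>W a b c. related X R W a b \<longrightarrow> related X R W b c \<longrightarrow> related X R W a c"
      and ac: "related X (rel_comp C X R R) W a c"
    obtain V d b where "cover d V W" "related X R V (a \<cdot> d) b" "related X R V b (c \<cdot> d)"
      using rel_compE[OF R R X ac] .
    then show "related X R W a c"
      using trans related_descent[OF R] related_in_hom[OF cp X ac] by blast
  qed
  ultimately show ?thesis unfolding equivalence_relation_def reflexive_relation_def using R by blast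
qed (simp add: equivalence_relation_def reflexive_relation_def)

lemma reflexive_relation_iff:
  assumes X: "X \<in> Ob C"
  shows "reflexive_relation C X R \<longleftrightarrow> R \<in> relations C X \<and> (\<forall>W a. in_hom C a W X \<longrightarrow> related X R W a a)"
proof (cases "R \<in> relations C X")
  case R: True
  show ?thesis
    unfolding reflexive_relation_def rel_le_iff_related[OF diagonal_in_relations[OF X] R X]
      related_diagonal[OF X] using R by blast
qed (simp add: reflexive_relation_def)

section \<open>Relations and objects defined by finitely many conditions\<close>

lemma total_relation:
  assumes X: "X \<in> Ob C"
  obtains Q where "Q \<in> relations C X"
    "\<And>W a b. related X Q W a b \<longleftrightarrow> in_hom C a W X \<and> in_hom C b W X"
proof -
  let ?i = "Id C (square C X)"
  have "is_mono C ?i" using X by (intro is_monoI) (auto simp: in_hom_def)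
  then have m: "mono_into X ?i" using X by (simp add: mono_into_def)
  have "factors X ?i W a b \<longleftrightarrow> in_hom C a W X \<and> in_hom C b W X" for W a b
  proof
    assume "factors X ?i W a b"
    then show "in_hom C a W X \<and> in_hom C b W X" using X by (auto simp: factors_def in_hom_def)
  next
    assume "in_hom C a W X \<and> in_hom C b W X"
    then have "in_hom C a W X" "in_hom C b W X" by auto
    note p = pairing[OF this]
    show "factors X ?i W a b"
      unfolding factors_def
      by (rule exI[of _ "pairing C X a b"]) (use p X in \<open>simp add: in_hom_def\<close>)
  qed
  then show ?thesis
    using that[OF subobject_class_in_relations[OF m]] related_subobject_class[OF m] by simp
qed

text \<open>With \<open>q\<close> and \<open>r\<close> representing \<open>Q\<close> and \<open>R\<close>, the new relation is \<open>q v\<close>, where \<open>v\<close> is the pullback of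
  \<open>r\<close> along \<open>(f \<times> f) q\<close>.\<close>

lemma conjoined_relation:
  assumes Q: "Q \<in> relations C Y" and R: "R \<in> relations C X" and f: "in_hom C f Y X"
  obtains Q' where "Q' \<in> relations C Y"
    "\<And>W a b. related Y Q' W a b \<longleftrightarrow> related Y Q W a b \<and> related X R W (f \<cdot> a) (f \<cdot> b)"
proof -
  have X: "X \<in> Ob C" and Y: "Y \<in> Ob C" using f by (auto simp: in_hom_def)
  obtain q where q: "mono_into Y q" and Qq: "\<And>W a b. related Y Q W a b \<longleftrightarrow> factors Y q W a b"
    using relationsE[OF Q Y] by metis
  obtain r where r: "mono_into X r" and Rr: "\<And>W a b. related X R W a b \<longleftrightarrow> factors X r W a b"
    using relationsE[OF R X] by metis
  note ar = mono_intoD[OF q] mono_intoD[OF r] f[unfolded in_hom_def]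
  define g where "g = pairing C X (f \<cdot> (proj1 C Y \<cdot> q)) (f \<cdot> (proj2 C Y \<cdot> q))"
  have "in_hom C (f \<cdot> (proj1 C Y \<cdot> q)) (Dom C q) X" "in_hom C (f \<cdot> (proj2 C Y \<cdot> q)) (Dom C q) X"
    using ar by (simp_all add: in_hom_def)
  note g = pairing[OF this, folded g_def]
  note gar = g(1)[unfolded in_hom_def]
  have gh: "proj1 C X \<cdot> (g \<cdot> h) = f \<cdot> (proj1 C Y \<cdot> (q \<cdot> h))" "proj2 C X \<cdot> (g \<cdot> h) = f \<cdot> (proj2 C Y \<cdot> (q \<cdot> h))"
    if h: "in_hom C h W (Dom C q)" for h W
  proof -
    note h = h[unfolded in_hom_def]
    have "proj1 C X \<cdot> (g \<cdot> h) = (proj1 C X \<cdot> g) \<cdot> h" using ar gar h by simp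
    also have "\<dots> = f \<cdot> (proj1 C Y \<cdot> (q \<cdot> h))" unfolding g(2) using ar h by simp
    finally show "proj1 C X \<cdot> (g \<cdot> h) = f \<cdot> (proj1 C Y \<cdot> (q \<cdot> h))" .
    have "proj2 C X \<cdot> (g \<cdot> h) = (proj2 C X \<cdot> g) \<cdot> h" using ar gar h by simp
    also have "\<dots> = f \<cdot> (proj2 C Y \<cdot> (q \<cdot> h))" unfolding g(3) using ar h by simp
    finally show "proj2 C X \<cdot> (g \<cdot> h) = f \<cdot> (proj2 C Y \<cdot> (q \<cdot> h))" .
  qed
  have rh: "in_hom C r (Dom C r) (square C X)" using ar by (simp add: in_hom_def)
  obtain u v where pb: "is_pullback C r g u v" using pullback_exists[OF rh g(1)] by blast
  note uv = pullbackD[OF pb]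
  have vm: "is_mono C v" using pullback_mono[OF pb] ar by blast
  have m: "mono_into Y (q \<cdot> v)"
    using comp_mono[OF _ vm, of q] ar gar uv(1-8) by (simp add: mono_into_def)
  have dqv: "Dom C (q \<cdot> v) = Dom C u" using ar gar uv(1-8) by simp
  have "factors Y (q \<cdot> v) W a b \<longleftrightarrow> factors Y q W a b \<and> factors X r W (f \<cdot> a) (f \<cdot> b)" for W a b
  proof
    assume "factors Y (q \<cdot> v) W a b"
    then obtain h where h: "in_hom C h W (Dom C u)" "proj1 C Y \<cdot> ((q \<cdot> v) \<cdot> h) = a" "proj2 C Y \<cdot> ((q \<cdot> v) \<cdot> h) = b"
      unfolding factors_def dqv by blast
    have assoc: "(q \<cdot> v) \<cdot> h = q \<cdot> (v \<cdot> h)" using h(1) ar gar uv(1-8) by (simp add: in_hom_def)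
    have vh: "in_hom C (v \<cdot> h) W (Dom C q)" using h(1) gar uv(1-8) by (simp add: in_hom_def)
    have uh: "in_hom C (u \<cdot> h) W (Dom C r)" using h(1) gar uv(1-8) by (simp add: in_hom_def)
    have "r \<cdot> (u \<cdot> h) = (r \<cdot> u) \<cdot> h" using h(1) uv(1-8) by (simp add: in_hom_def)
    also have "\<dots> = g \<cdot> (v \<cdot> h)" unfolding uv(9) using h(1) uv(1-8) by (simp add: in_hom_def)
    finally have "r \<cdot> (u \<cdot> h) = g \<cdot> (v \<cdot> h)" .
    then show "factors Y q W a b \<and> factors X r W (f \<cdot> a) (f \<cdot> b)"
      unfolding factors_def using vh uh h(2,3) gh[OF vh] unfolding assoc by metis
  next
    assume "factors Y q W a b \<and> factors X r W (f \<cdot> a) (f \<cdot> b)"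
    then obtain h k where h: "in_hom C h W (Dom C q)" "proj1 C Y \<cdot> (q \<cdot> h) = a" "proj2 C Y \<cdot> (q \<cdot> h) = b"
      and k: "in_hom C k W (Dom C r)" "proj1 C X \<cdot> (r \<cdot> k) = f \<cdot> a" "proj2 C X \<cdot> (r \<cdot> k) = f \<cdot> b"
      unfolding factors_def by blast
    have "r \<cdot> k = g \<cdot> h"
      by (rule square_ext[OF X, of _ W])
        (use h(1) k(1) ar gar in \<open>simp_all add: in_hom_def gh[OF h(1)] h(2,3) k(2,3)\<close>)
    moreover have "in_hom C h W (Dom C g)" using h(1) gar by simp
    ultimately obtain l where l: "in_hom C l W (Dom C u)" "u \<cdot> l = k" "v \<cdot> l = h"
      using pullback_lift[OF pb k(1)] by metis
    have "(q \<cdot> v) \<cdot> l = q \<cdot> h"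
      unfolding l(3)[symmetric] using l(1) ar gar uv(1-8) by (simp add: in_hom_def)
    then show "factors Y (q \<cdot> v) W a b" unfolding factors_def dqv using l(1) h(2,3) by auto
  qed
  then show ?thesis
    using that[OF subobject_class_in_relations[OF m]] related_subobject_class[OF m] Qq Rr by simp
qed

lemma relation_of_conditions:
  assumes "finite I" and Y: "Y \<in> Ob C"
    and "\<And>i. i \<in> I \<Longrightarrow> R i \<in> relations C X" "\<And>i. i \<in> I \<Longrightarrow> in_hom C (f i) Y X"
  shows "\<exists>Q\<in>relations C Y. \<forall>W a b. related Y Q W a b \<longleftrightarrow>
    in_hom C a W Y \<and> in_hom C b W Y \<and> (\<forall>i\<in>I. related X (R i) W (f i \<cdot> a) (f i \<cdot> b))"
  using assms(1,3,4)
proof (induction I rule: finite_induct)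
  case empty
  obtain Q where "Q \<in> relations C Y" "\<And>W a b. related Y Q W a b \<longleftrightarrow> in_hom C a W Y \<and> in_hom C b W Y"
    using total_relation[OF Y] by blast
  then show ?case by auto
next
  case (insert j I)
  then obtain Q where Q: "Q \<in> relations C Y" "\<And>W a b. related Y Q W a b \<longleftrightarrow>
    in_hom C a W Y \<and> in_hom C b W Y \<and> (\<forall>i\<in>I. related X (R i) W (f i \<cdot> a) (f i \<cdot> b))"
    by (auto simp: Ball_def)
  have "R j \<in> relations C X" "in_hom C (f j) Y X" using insert.prems by auto
  then obtain Q' where "Q' \<in> relations C Y"
    "\<And>W a b. related Y Q' W a b \<longleftrightarrow> related Y Q W a b \<and> related X (R j) W (f j \<cdot> a) (f j \<cdot> b)"
    using conjoined_relation[OF Q(1)] by metis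
  then show ?case using Q(2) by (intro bexI[of _ Q']) auto
qed

text \<open>A weak limit: lifts are asked to exist only, since the relations put on \<open>P\<close> below see an arrow
  into \<open>P\<close> through its coordinates alone.\<close>

definition path_object :: "'a \<Rightarrow> (nat \<Rightarrow> 'b set) \<Rightarrow> nat \<Rightarrow> 'a \<Rightarrow> (nat \<Rightarrow> 'b) \<Rightarrow> bool" where
  "path_object X R k P pr \<longleftrightarrow> P \<in> Ob C \<and> (\<forall>i\<le>k. in_hom C (pr i) P X) \<and>
     (\<forall>i<k. related X (R i) P (pr i) (pr (Suc i))) \<and>
     (\<forall>W x. (\<forall>i\<le>k. in_hom C (x i) W X) \<and> (\<forall>i<k. related X (R i) W (x i) (x (Suc i))) \<longrightarrow>
        (\<exists>h. in_hom C h W P \<and> (\<forall>i\<le>k. pr i \<cdot> h = x i)))"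

lemma path_object_exists:
  assumes X: "X \<in> Ob C" and R: "\<And>i. R i \<in> relations C X"
  shows "\<exists>P pr. path_object X R k P pr"
proof (induction k)
  case 0
  have "\<exists>h. in_hom C h W X \<and> Id C X \<cdot> h = x 0" if "in_hom C (x 0) W X" for W and x :: "nat \<Rightarrow> 'b"
    by (rule exI[of _ "x 0"]) (use X that in \<open>simp add: in_hom_def\<close>)
  then have "path_object X R 0 X (\<lambda>i. Id C X)" using X by (simp add: path_object_def in_hom_def)
  then show ?case by blast
next
  case (Suc k)
  then obtain P pr where po: "path_object X R k P pr" by blast
  then have P: "P \<in> Ob C" and pr: "\<And>i. i \<le> k \<Longrightarrow> in_hom C (pr i) P X"
    and rel: "\<And>i. i < k \<Longrightarrow> related X (R i) P (pr i) (pr (Suc i))"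
    and lift: "\<And>W x. (\<And>i. i \<le> k \<Longrightarrow> in_hom C (x i) W X) \<Longrightarrow> (\<And>i. i < k \<Longrightarrow> related X (R i) W (x i) (x (Suc i)))
      \<Longrightarrow> \<exists>h. in_hom C h W P \<and> (\<forall>i\<le>k. pr i \<cdot> h = x i)"
    by (simp_all add: path_object_def)
  obtain r where r: "mono_into X r" and Rr: "\<And>W a b. related X (R k) W a b \<longleftrightarrow> factors X r W a b"
    using relationsE[OF R X] by metis
  note ar = mono_intoD[OF r]
  have r1: "in_hom C (proj1 C X \<cdot> r) (Dom C r) X" using ar by (simp add: in_hom_def)
  obtain u v where pb: "is_pullback C (pr k) (proj1 C X \<cdot> r) u v"
    using pullback_exists[OF pr[OF order_refl] r1] by blast
  have prk: "Dom C (pr k) = P" "Dom C (proj1 C X \<cdot> r) = Dom C r" using pr[of k] ar by (simp_all add: in_hom_def)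
  note uv = pullbackD[OF pb, unfolded prk]
  define pr' where "pr' i = (if i \<le> k then pr i \<cdot> u else proj2 C X \<cdot> (r \<cdot> v))" for i
  have u: "in_hom C u (Dom C u) P" using uv by (simp add: in_hom_def)
  have v: "in_hom C v (Dom C u) (Dom C r)" using uv by (simp add: in_hom_def)
  have "pr k \<cdot> u = proj1 C X \<cdot> (r \<cdot> v)" unfolding uv(9) using uv(1-8) ar by simp
  then have last: "related X (R k) (Dom C u) (pr k \<cdot> u) (proj2 C X \<cdot> (r \<cdot> v))"
    unfolding Rr factors_def using v by auto
  have "in_hom C (pr' i) (Dom C u) X" if "i \<le> Suc k" for i
  proof (cases "i \<le> k")
    case True
    then show ?thesis unfolding pr'_def using comp_in_hom[OF u pr] by simp
  next
    case False
    then show ?thesis unfolding pr'_def using v ar by (simp add: in_hom_def)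
  qed
  moreover have "related X (R i) (Dom C u) (pr' i) (pr' (Suc i))" if "i < Suc k" for i
  proof (cases "i < k")
    case True
    then show ?thesis unfolding pr'_def using related_comp[OF R X rel u] by simp
  next
    case False
    then have "i = k" using that by simp
    then show ?thesis unfolding pr'_def using last by simp
  qed
  moreover have "\<exists>h. in_hom C h W (Dom C u) \<and> (\<forall>i\<le>Suc k. pr' i \<cdot> h = x i)"
    if x: "\<forall>i\<le>Suc k. in_hom C (x i) W X" and xR: "\<forall>i<Suc k. related X (R i) W (x i) (x (Suc i))" for W x
  proof -
    obtain h where h: "in_hom C h W P" "\<And>i. i \<le> k \<Longrightarrow> pr i \<cdot> h = x i"
      using lift[of x W] x xR by auto
    have "related X (R k) W (x k) (x (Suc k))" using xR by simp
    then obtain t where t: "in_hom C t W (Dom C r)" "proj1 C X \<cdot> (r \<cdot> t) = x k" "proj2 C X \<cdot> (r \<cdot> t) = x (Suc k)"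
      unfolding Rr factors_def by blast
    have "pr k \<cdot> h = (proj1 C X \<cdot> r) \<cdot> t" using h(2)[of k] t(1,2) ar by (simp add: in_hom_def)
    then obtain l where l: "in_hom C l W (Dom C u)" "u \<cdot> l = h" "v \<cdot> l = t"
      using pullback_lift[OF pb, unfolded prk, OF h(1) t(1)] by blast
    have "pr' i \<cdot> l = x i" if "i \<le> Suc k" for i
    proof (cases "i \<le> k")
      case True
      then have "pr' i \<cdot> l = pr i \<cdot> (u \<cdot> l)"
        unfolding pr'_def using pr[OF True] u l(1) by (simp add: in_hom_def)
      then show ?thesis using l(2) h(2)[OF True] by simp
    next
      case False
      then have "i = Suc k" using that by simp
      have "pr' i \<cdot> l = proj2 C X \<cdot> (r \<cdot> (v \<cdot> l))"
        unfolding pr'_def using False v l(1) ar by (simp add: in_hom_def)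
      then show ?thesis using l(3) t(3) \<open>i = Suc k\<close> by simp
    qed
    then show ?thesis using l(1) by blast
  qed
  moreover have "Dom C u \<in> Ob C" using uv by simp
  ultimately have "path_object X R (Suc k) (Dom C u) pr'" unfolding path_object_def by blast
  then show ?case by blast
qed

section \<open>Powers and alternating products\<close>

lemma rel_pow_in_relations:
  assumes "R \<in> relations C X" "X \<in> Ob C"
  shows "rel_pow C X R k \<in> relations C X"
proof (induction k)
  case (Suc k)
  then show ?case by (cases k) (use assms rel_comp_in_relations in auto)
qed (use assms diagonal_in_relations in simp)

text \<open>Together with the next lemma this treats the powers uniformly from exponent \<open>0\<close> on, although
  the first power is \<open>R\<close> itself and not a composite with the diagonal.\<close>

lemma rel_pow_SucI:
  assumes R: "R \<in> relations C X" and X: "X \<in> Ob C"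
    and "related X (rel_pow C X R k) W a b" "related X R W b c"
  shows "related X (rel_pow C X R (Suc k)) W a c"
proof (cases k)
  case 0
  then show ?thesis using assms related_diagonal[OF X] by simp
next
  case (Suc j)
  then show ?thesis using assms rel_compI[OF rel_pow_in_relations[OF R X] R X] by simp
qed

lemma rel_pow_SucE:
  assumes R: "R \<in> relations C X" and X: "X \<in> Ob C"
    and ac: "related X (rel_pow C X R (Suc k)) W a c"
  obtains V d b where "cover d V W" "related X (rel_pow C X R k) V (a \<cdot> d) b" "related X R V b (c \<cdot> d)"
proof (cases k)
  case 0
  then have ac: "related X R W a c" using ac by simp
  note hom = related_in_hom[OF R X ac]
  then have W: "W \<in> Ob C" by (auto simp: in_hom_def)
  have "a \<cdot> Id C W = a" "c \<cdot> Id C W = c" using hom by (simp_all add: in_hom_def)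
  then show ?thesis
    using that[OF cover_id[OF W], of a] ac hom 0 related_diagonal[OF X] by simp
next
  case (Suc j)
  then have "related X (rel_comp C X R (rel_pow C X R (Suc j))) W a c" using ac by simp
  then show ?thesis using rel_compE[OF rel_pow_in_relations[OF R X] R X] that Suc by blast
qed

lemma rel_pow_chainI:
  assumes R: "R \<in> relations C X" and X: "X \<in> Ob C"
    and "in_hom C (x 0) W X" "\<And>i. i < k \<Longrightarrow> related X R W (x i) (x (Suc i))"
  shows "related X (rel_pow C X R k) W (x 0) (x k)"
  using assms(4)
proof (induction k)
  case 0
  then show ?case using assms(3) related_diagonal[OF X] by simp
next
  case (Suc k)
  then show ?case using rel_pow_SucI[OF R X] by simp
qed

lemma rel_pow_chainE:
  assumes R: "R \<in> relations C X" and X: "X \<in> Ob C"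
    and "related X (rel_pow C X R k) W a b"
  shows "\<exists>V d x. cover d V W \<and> x 0 = a \<cdot> d \<and> x k = b \<cdot> d \<and> (\<forall>i<k. related X R V (x i) (x (Suc i)))"
  using assms(3)
proof (induction k arbitrary: W a b)
  case 0
  then have ab: "in_hom C a W X" "b = a" using related_diagonal[OF X] by auto
  then have "W \<in> Ob C" by (auto simp: in_hom_def)
  then show ?case using ab cover_id by (intro exI[of _ W] exI[of _ "Id C W"] exI[of _ "\<lambda>i. a \<cdot> Id C W"]) simp
next
  case (Suc k)
  note hom = related_in_hom[OF rel_pow_in_relations[OF R X] X Suc.prems]
  obtain V d c where d: "cover d V W" and ac: "related X (rel_pow C X R k) V (a \<cdot> d) c"
    and cb: "related X R V c (b \<cdot> d)"
    using rel_pow_SucE[OF R X Suc.prems] by blast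
  obtain U e x where e: "cover e U V" and x: "x 0 = (a \<cdot> d) \<cdot> e" "x k = c \<cdot> e"
    "\<And>i. i < k \<Longrightarrow> related X R U (x i) (x (Suc i))"
    using Suc.IH[OF ac] by blast
  note de = cover_in_hom[OF d, unfolded in_hom_def] cover_in_hom[OF e, unfolded in_hom_def]
  define y where "y i = (if i \<le> k then x i else b \<cdot> (d \<cdot> e))" for i
  have "related X R U (c \<cdot> e) ((b \<cdot> d) \<cdot> e)" by (rule related_comp[OF R X cb cover_in_hom[OF e]])
  then have "related X R U (x k) (b \<cdot> (d \<cdot> e))" using x(2) hom de by (simp add: in_hom_def)
  then have "related X R U (y i) (y (Suc i))" if "i < Suc k" for i
    using that x(3)[of i] unfolding y_def by (cases "i = k") auto
  moreover have "y 0 = a \<cdot> (d \<cdot> e)" "y (Suc k) = b \<cdot> (d \<cdot> e)"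
    using x(1) hom de unfolding y_def by (simp_all add: in_hom_def)
  ultimately show ?case using cover_comp[OF d e] by blast
qed

lemma alternating_in_relations:
  assumes "R \<in> relations C X" "S \<in> relations C X" "X \<in> Ob C"
  shows "alternating C X R S k \<in> relations C X"
  using assms(1,2)
proof (induction k arbitrary: R S)
  case 0
  then show ?case using diagonal_in_relations[OF assms(3)] by simp
next
  case (Suc k)
  show ?case
  proof (cases k)
    case (Suc j)
    then show ?thesis
      using Suc.IH[OF Suc.prems(2,1)] rel_comp_in_relations[OF _ Suc.prems(1) assms(3)] by simp
  qed (use Suc.prems in simp)
qed

text \<open>Chains are numbered against the direction of the relation, because the known factor of an
  alternating product is the one applied last.\<close>

lemma alternating_chainI:
  assumes "R \<in> relations C X" "S \<in> relations C X" "X \<in> Ob C"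
    and "\<And>i. i < Suc k \<Longrightarrow> related X (if even i then R else S) W (x (Suc i)) (x i)"
  shows "related X (alternating C X R S (Suc k)) W (x (Suc k)) (x 0)"
  using assms(1,2,4)
proof (induction k arbitrary: R S x)
  case 0
  then show ?case using 0(3)[of 0] by simp
next
  case (Suc k)
  have "related X (alternating C X S R (Suc k)) W (x (Suc (Suc k))) (x (Suc 0))"
  proof (rule Suc.IH[OF Suc.prems(2,1), of "\<lambda>i. x (Suc i)"])
    show "related X (if even i then S else R) W (x (Suc (Suc i))) (x (Suc i))" if "i < Suc k" for i
      using Suc.prems(3)[of "Suc i"] that by (cases "even i") auto
  qed
  moreover have "related X R W (x (Suc 0)) (x 0)" using Suc.prems(3)[of 0] by simp
  ultimately show ?case
    using rel_compI[OF alternating_in_relations[OF Suc.prems(2,1) assms(3)] Suc.prems(1) assms(3)] by simp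
qed

lemma alternating_chainE:
  assumes "R \<in> relations C X" "S \<in> relations C X" "X \<in> Ob C"
    and "related X (alternating C X R S (Suc k)) W a b"
  shows "\<exists>V d x. cover d V W \<and> x (Suc k) = a \<cdot> d \<and> x 0 = b \<cdot> d \<and>
    (\<forall>i<Suc k. related X (if even i then R else S) V (x (Suc i)) (x i))"
  using assms(1,2,4)
proof (induction k arbitrary: R S W a b)
  case 0
  have ab: "related X R W a b" using 0 by simp
  note hom = related_in_hom[OF 0(1) assms(3) ab]
  then have W: "W \<in> Ob C" by (auto simp: in_hom_def)
  have "a \<cdot> Id C W = a" "b \<cdot> Id C W = b" using hom by (simp_all add: in_hom_def)
  then show ?case
    using ab cover_id[OF W]
    by (intro exI[of _ W] exI[of _ "Id C W"] exI[of _ "\<lambda>i. if i = 0 then b else a"]) simp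
next
  case (Suc k)
  note X = assms(3) and R = Suc.prems(1) and S = Suc.prems(2)
  note A = alternating_in_relations[OF S R X]
  note hom = related_in_hom[OF alternating_in_relations[OF R S X] X Suc.prems(3)]
  have "related X (rel_comp C X R (alternating C X S R (Suc k))) W a b" using Suc.prems(3) by simp
  then obtain V d c where d: "cover d V W" and ac: "related X (alternating C X S R (Suc k)) V (a \<cdot> d) c"
    and cb: "related X R V c (b \<cdot> d)"
    by (rule rel_compE[OF A R X])
  obtain U e x where e: "cover e U V" and x: "x (Suc k) = (a \<cdot> d) \<cdot> e" "x 0 = c \<cdot> e"
    "\<And>i. i < Suc k \<Longrightarrow> related X (if even i then S else R) U (x (Suc i)) (x i)"
    using Suc.IH[OF S R ac] by blast
  note de = cover_in_hom[OF d, unfolded in_hom_def] cover_in_hom[OF e, unfolded in_hom_def]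
  define y where "y i = (case i of 0 \<Rightarrow> b \<cdot> (d \<cdot> e) | Suc i \<Rightarrow> x i)" for i
  have "related X R U (c \<cdot> e) ((b \<cdot> d) \<cdot> e)" by (rule related_comp[OF R X cb cover_in_hom[OF e]])
  then have 0: "related X R U (x 0) (b \<cdot> (d \<cdot> e))" using x(2) hom de by (simp add: in_hom_def)
  have "related X (if even i then R else S) U (y (Suc i)) (y i)" if "i < Suc (Suc k)" for i
  proof (cases i)
    case (Suc j)
    then show ?thesis using x(3)[of j] that unfolding y_def by (cases "even j") auto
  qed (use 0 in \<open>simp add: y_def\<close>)
  moreover have "y (Suc (Suc k)) = a \<cdot> (d \<cdot> e)" "y 0 = b \<cdot> (d \<cdot> e)"
    using x(1) hom de unfolding y_def by (simp_all add: in_hom_def)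
  ultimately show ?case using cover_comp[OF d e] by blast
qed

text \<open>The factor applied last is \<open>R\<close>, so one more step along \<open>R\<close> is swallowed by transitivity.\<close>

lemma alternating_absorb:
  assumes R: "equivalence_relation C X R" and S: "S \<in> relations C X" and X: "X \<in> Ob C"
    and ab: "related X (alternating C X R S (Suc k)) W a b" and bc: "related X R W b c"
  shows "related X (alternating C X R S (Suc k)) W a c"
proof -
  have Rr: "R \<in> relations C X" and trans: "\<And>W a b c. related X R W a b \<Longrightarrow> related X R W b c \<Longrightarrow> related X R W a c"
    using R unfolding equivalence_relation_iff[OF X] by blast+
  show ?thesis
  proof (cases k)
    case 0
    then show ?thesis using ab bc trans[of W a b c] by simp
  next
    case (Suc j)
    note A = alternating_in_relations[OF S Rr X]
    have hom: "in_hom C a W X" "in_hom C c W X"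
      using related_in_hom[OF alternating_in_relations[OF Rr S X] X ab] related_in_hom[OF Rr X bc] by auto
    have "related X (rel_comp C X R (alternating C X S R (Suc j))) W a b" using ab Suc by simp
    then obtain V d m where d: "cover d V W" and am: "related X (alternating C X S R (Suc j)) V (a \<cdot> d) m"
      and mb: "related X R V m (b \<cdot> d)" by (rule rel_compE[OF A Rr X])
    have "related X R V m (c \<cdot> d)"
      by (rule trans[OF mb related_comp[OF Rr X bc cover_in_hom[OF d]]])
    then show ?thesis using am d hom Suc related_rel_comp[OF A Rr X] by auto
  qed
qed

lemma alternating_SucI:
  assumes "R \<in> relations C X" "S \<in> relations C X" "X \<in> Ob C"
    and "related X (alternating C X S R (Suc k)) W a b" "related X R W b c"
  shows "related X (alternating C X R S (Suc (Suc k))) W a c"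
  using rel_compI[OF alternating_in_relations[OF assms(2,1,3)] assms(1,3,4,5)] by simp

section \<open>Permutability makes powers of reflexive relations equivalences\<close>

text \<open>The element \<open>h i\<close> is the path \<open>(u\<^sub>0, \<dots>, u\<^sub>i\<^sub>-\<^sub>1, v\<^sub>i, \<dots>, v\<^sub>n)\<close>; the three assumptions on \<open>u\<close> and \<open>v\<close> say
  that it is one.  As \<open>h i\<close> and \<open>h (i + 1)\<close> differ in coordinate \<open>i\<close> alone, they agree in all
  coordinates of the other parity, which makes \<open>h\<close> an alternating chain from \<open>v\<close> to \<open>u\<close>.  The chain
  \<open>y\<close> provided by permutability alternates the other way round: \<open>y i\<close> and \<open>y (i + 1)\<close> agree in
  coordinate \<open>i\<close>.  So coordinate \<open>i\<close> of \<open>y i\<close> equals coordinate \<open>i\<close> of the path \<open>y (i + 1)\<close>, which is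
  \<open>E\<close>-related to coordinate \<open>i + 1\<close> of that same path.\<close>

lemma related_alternating_path_swap:
  assumes perm: "congruence_permutable C (Suc n)" and X: "X \<in> Ob C"
    and E: "reflexive_relation C X E"
    and u: "in_hom C (u 0) W X" "\<And>l. l < n \<Longrightarrow> related X E W (u l) (u (Suc l))"
    and v: "in_hom C (v 0) W X" "\<And>l. l < n \<Longrightarrow> related X E W (v l) (v (Suc l))"
    and uv: "\<And>l. l < n \<Longrightarrow> related X E W (u l) (v (Suc l))"
  shows "related X (rel_pow C X E n) W (v 0) (u n)"
proof -
  have Er: "E \<in> relations C X" using E by (simp add: reflexive_relation_def)
  have "in_hom C (x l) W X"
    if "in_hom C (x 0) W X" "\<And>l. l < n \<Longrightarrow> related X E W (x l) (x (Suc l))" "l \<le> n" for x l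
  proof (cases l)
    case (Suc k)
    then show ?thesis using related_in_hom(2)[OF Er X that(2)[of k]] that(3) by simp
  qed (use that(1) in simp)
  from this[of u, OF u] this[of v, OF v] have hom: "in_hom C (u l) W X" "in_hom C (v l) W X" if "l \<le> n" for l
    using that by blast+
  obtain P pr where po: "path_object X (\<lambda>i. E) n P pr" using path_object_exists[OF X Er] by blast
  then have P: "P \<in> Ob C" and pr: "\<And>i. i \<le> n \<Longrightarrow> in_hom C (pr i) P X"
    and prE: "\<And>i. i < n \<Longrightarrow> related X E P (pr i) (pr (Suc i))"
    by (simp_all add: path_object_def)
  have "\<exists>K. \<forall>\<beta>. K \<beta> \<in> relations C P \<and> (\<forall>W a b. related P (K \<beta>) W a b \<longleftrightarrow>
    in_hom C a W P \<and> in_hom C b W P \<and> (\<forall>l\<in>{l. l \<le> n \<and> even l = \<beta>}. related X (diagonal C X) W (pr l \<cdot> a) (pr l \<cdot> b)))"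
  proof (rule choice, rule allI, fold Bex_def)
    show "\<exists>K\<in>relations C P. \<forall>W a b. related P K W a b \<longleftrightarrow>
      in_hom C a W P \<and> in_hom C b W P \<and> (\<forall>l\<in>{l. l \<le> n \<and> even l = \<beta>}. related X (diagonal C X) W (pr l \<cdot> a) (pr l \<cdot> b))" for \<beta>
      by (rule relation_of_conditions[OF _ P]) (use diagonal_in_relations[OF X] pr in auto)
  qed
  then obtain K where K: "\<And>\<beta>. K \<beta> \<in> relations C P" and K0: "\<And>\<beta> W a b. related P (K \<beta>) W a b \<longleftrightarrow>
    in_hom C a W P \<and> in_hom C b W P \<and> (\<forall>l\<in>{l. l \<le> n \<and> even l = \<beta>}. related X (diagonal C X) W (pr l \<cdot> a) (pr l \<cdot> b))"
    by blast
  have "related X (diagonal C X) W (pr l \<cdot> a) (pr l \<cdot> b) \<longleftrightarrow> pr l \<cdot> a = pr l \<cdot> b"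
    if "l \<le> n" "in_hom C a W P" for W a b l
    unfolding related_diagonal[OF X] using comp_in_hom[OF that(2) pr[OF that(1)]] by metis
  then have Kiff: "related P (K \<beta>) W a b \<longleftrightarrow>
    in_hom C a W P \<and> in_hom C b W P \<and> (\<forall>l\<le>n. even l = \<beta> \<longrightarrow> pr l \<cdot> a = pr l \<cdot> b)" for \<beta> W a b
    unfolding K0 by blast
  have Keq: "equivalence_relation C P (K \<beta>)" for \<beta>
    unfolding equivalence_relation_iff[OF P] Kiff using K by simp
  define q where "q i l = (if l < i then u l else v l)" for i l
  have "\<exists>h. in_hom C h W P \<and> (\<forall>l\<le>n. pr l \<cdot> h = q i l)" for i
  proof -
    have "\<forall>l\<le>n. in_hom C (q i l) W X" using hom by (simp add: q_def)
    moreover have "\<forall>l<n. related X E W (q i l) (q i (Suc l))" using u v uv by (simp add: q_def)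
    ultimately show ?thesis using po unfolding path_object_def by blast
  qed
  then obtain h where h: "\<And>i. in_hom C (h i) W P" "\<And>i l. l \<le> n \<Longrightarrow> pr l \<cdot> h i = q i l" by metis
  have "related P (alternating C P (K False) (K True) (Suc n)) W (h (Suc n)) (h 0)"
  proof (rule alternating_chainI[OF K K P])
    show "related P (if even i then K False else K True) W (h (Suc i)) (h i)" if "i < Suc n" for i
      using h by (auto simp: Kiff q_def less_Suc_eq)
  qed
  moreover have "alternating C P (K False) (K True) (Suc n) = alternating C P (K True) (K False) (Suc n)"
    using perm P Keq unfolding congruence_permutable_def by blast
  ultimately have "related P (alternating C P (K True) (K False) (Suc n)) W (h (Suc n)) (h 0)" by simp
  from alternating_chainE[OF K K P this]
  obtain V d y where d: "cover d V W" and y: "y (Suc n) = h (Suc n) \<cdot> d" "y 0 = h 0 \<cdot> d"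
    and yK: "\<And>i. i < Suc n \<Longrightarrow> related P (if even i then K True else K False) V (y (Suc i)) (y i)"
    by blast
  have yh: "in_hom C (y (Suc i)) V P" and step: "pr i \<cdot> y (Suc i) = pr i \<cdot> y i" if "i \<le> n" for i
    using yK[of i] that by (auto simp: Kiff split: if_splits)
  have pry: "pr l \<cdot> (h i \<cdot> d) = q i l \<cdot> d" if "l \<le> n" for i l
    using comp_assoc_arrows[of d "h i" "pr l"] h(1)[of i] h(2)[OF that, of i] pr[OF that] cover_in_hom[OF d]
    by (simp add: in_hom_def)
  have c: "related X E V (pr i \<cdot> y (Suc i)) (pr (Suc i) \<cdot> y (Suc (Suc i)))" if "i < n" for i
    using related_comp[OF Er X prE[OF that] yh[of i]] step[of "Suc i"] that by simp
  have "in_hom C (pr 0 \<cdot> y (Suc 0)) V X" using comp_in_hom[OF yh pr] by simp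
  from rel_pow_chainI[OF Er X, of "\<lambda>i. pr i \<cdot> y (Suc i)", OF this c]
  have "related X (rel_pow C X E n) V (pr 0 \<cdot> y (Suc 0)) (pr n \<cdot> y (Suc n))" by simp
  moreover have "pr 0 \<cdot> y (Suc 0) = v 0 \<cdot> d" using step[of 0] y(2) pry[of 0 0] by (simp add: q_def)
  moreover have "pr n \<cdot> y (Suc n) = u n \<cdot> d" using y(1) pry[of n "Suc n"] by (simp add: q_def)
  ultimately have "related X (rel_pow C X E n) V (v 0 \<cdot> d) (u n \<cdot> d)" by simp
  then show ?thesis
    using related_descent[OF rel_pow_in_relations[OF Er X] d] hom by auto
qed

lemma permutable_imp_rel_pow_equivalence:
  assumes perm: "congruence_permutable C (Suc n)" and n: "n \<ge> 1" and X: "X \<in> Ob C"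
    and E: "reflexive_relation C X E"
  shows "equivalence_relation C X (rel_pow C X E n)"
proof -
  have Er: "E \<in> relations C X" and refl: "\<And>W a. in_hom C a W X \<Longrightarrow> related X E W a a"
    using E unfolding reflexive_relation_iff[OF X] by blast+
  note pow = rel_pow_in_relations[OF Er X]
  note swap = related_alternating_path_swap[OF perm X E]
  \<comment> \<open>\<open>E\<^sup>o\<^sup>p \<subseteq> E\<^sup>n\<close>: turn the constant path at \<open>b\<close> into the constant path at \<open>a\<close>\<close>
  have op: "related X (rel_pow C X E n) W b a" if ab: "related X E W a b" for W a b
    using swap[of "\<lambda>l. a" W "\<lambda>l. b"] related_in_hom[OF Er X ab] refl ab by blast
  \<comment> \<open>\<open>E\<^sup>n\<^sup>+\<^sup>1 \<subseteq> E\<^sup>n\<close>: turn the first \<open>n + 1\<close> points of a path of length \<open>n + 1\<close> into the last \<open>n + 1\<close>\<close>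
  have Suc_pow: "related X (rel_pow C X E n) W a b" if ab: "related X (rel_pow C X E (Suc n)) W a b" for W a b
  proof -
    obtain V d x where d: "cover d V W" and x: "x 0 = a \<cdot> d" "x (Suc n) = b \<cdot> d"
      "\<And>i. i < Suc n \<Longrightarrow> related X E V (x i) (x (Suc i))"
      using rel_pow_chainE[OF Er X ab] by blast
    have hom: "in_hom C (x i) V X" if "i \<le> Suc n" for i
      using related_in_hom[OF Er X x(3)] that by (cases i) auto
    have "related X (rel_pow C X E n) V (x 0) (x (Suc n))"
      using swap[of "\<lambda>l. x (Suc l)" V x] hom x(3) refl by simp
    then show ?thesis
      using related_descent[OF pow d related_in_hom[OF pow X ab]] x by simp
  qed
  \<comment> \<open>\<open>E\<^sup>k E\<^sup>n \<subseteq> E\<^sup>n\<close> for every \<open>k\<close>; transitivity is the case \<open>k = n\<close>\<close>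
  have trans: "related X (rel_pow C X E n) W a c"
    if "related X (rel_pow C X E n) W a b" "related X (rel_pow C X E k) W b c" for W a b c k
    using that
  proof (induction k arbitrary: W b a c)
    case 0
    then show ?case using related_diagonal[OF X] by simp
  next
    case (Suc k)
    obtain V d m where d: "cover d V W" and bm: "related X (rel_pow C X E k) V (b \<cdot> d) m"
      and mc: "related X E V m (c \<cdot> d)"
      using rel_pow_SucE[OF Er X Suc.prems(2)] by blast
    have "related X (rel_pow C X E n) V (a \<cdot> d) m"
      by (rule Suc.IH[OF related_comp[OF pow X Suc.prems(1) cover_in_hom[OF d]] bm])
    then have "related X (rel_pow C X E n) V (a \<cdot> d) (c \<cdot> d)"
      using Suc_pow rel_pow_SucI[OF Er X _ mc] by blast
    then show ?case
      using related_descent[OF pow d] related_in_hom[OF pow X] Suc.prems by blast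
  qed
  have sym: "related X (rel_pow C X E n) W b a" if "related X (rel_pow C X E (Suc k)) W a b" for W a b k
    using that
  proof (induction k arbitrary: W a b)
    case 0
    then show ?case using op by simp
  next
    case (Suc k)
    obtain V d m where d: "cover d V W" and am: "related X (rel_pow C X E (Suc k)) V (a \<cdot> d) m"
      and mb: "related X E V m (b \<cdot> d)"
      using rel_pow_SucE[OF Er X Suc.prems] by blast
    have "related X (rel_pow C X E n) V (b \<cdot> d) (a \<cdot> d)" by (rule trans[OF op[OF mb] Suc.IH[OF am]])
    then show ?case using related_descent[OF pow d] related_in_hom[OF pow X Suc.prems] by blast
  qed
  have "related X (rel_pow C X E n) W a a" if "in_hom C a W X" for W a
    using rel_pow_chainI[OF Er X, of "\<lambda>i. a" W n] that refl by simp
  moreover obtain k where "n = Suc k" using n by (cases n) auto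
  ultimately show ?thesis
    unfolding equivalence_relation_iff[OF X] using pow sym trans by blast
qed

section \<open>Equivalence powers give permutability\<close>

text \<open>Since \<open>n = N + 1\<close>, paths have the points \<open>0, \<dots>, N\<close>.  Walking from \<open>(c\<^sub>2, \<dots>, c\<^sub>N\<^sub>+\<^sub>2)\<close> back to
  \<open>(c\<^sub>0, \<dots>, c\<^sub>N)\<close> along \<open>E\<close>, one looks at coordinate \<open>N - j\<close> after \<open>j\<close> steps.  An \<open>E\<close>-step at coordinate
  \<open>i\<close> consists of \<open>T\<^sub>i\<close>, absorbed by the product obtained so far, and of \<open>T\<^sub>i\<^sub>+\<^sub>1 = T\<^sub>i\<^sub>-\<^sub>1\<close>, which is the
  one new factor; it also absorbs the move to coordinate \<open>i - 1\<close> inside the path that was reached.\<close>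

lemma rel_pow_equivalence_imp_alternating_le:
  assumes hyp: "\<And>X E. X \<in> Ob C \<Longrightarrow> reflexive_relation C X E \<Longrightarrow> equivalence_relation C X (rel_pow C X E (Suc N))"
    and X: "X \<in> Ob C" and R: "equivalence_relation C X R" and S: "equivalence_relation C X S"
    and ad: "related X (alternating C X R S (Suc (Suc N))) W a d"
  shows "related X (alternating C X S R (Suc (Suc N))) W a d"
proof -
  define T where "T i = (if even i then R else S)" for i :: nat
  have Teq: "equivalence_relation C X (T i)" for i using R S by (simp add: T_def)
  have T: "T i \<in> relations C X" and refl: "\<And>W a. in_hom C a W X \<Longrightarrow> related X (T i) W a a"
    and sym: "\<And>W a b. related X (T i) W a b \<Longrightarrow> related X (T i) W b a"
    and trans: "\<And>W a b c. related X (T i) W a b \<Longrightarrow> related X (T i) W b c \<Longrightarrow> related X (T i) W a c" for i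
    using Teq[of i] unfolding equivalence_relation_iff[OF X] by blast+
  have T2: "T (Suc (Suc i)) = T i" for i by (simp add: T_def)
  have TR: "T 0 = R" "T (Suc 0) = S" by (simp_all add: T_def)
  note alt = alternating_in_relations[OF T T X]
  \<comment> \<open>\<open>T\<^sub>i\<close> followed by \<open>T\<^sub>i\<^sub>+\<^sub>1\<close>, the condition that \<open>E\<close> puts on coordinate \<open>i\<close>\<close>
  define TT where "TT i = rel_comp C X (T (Suc i)) (T i)" for i
  have TTr: "TT i \<in> relations C X" for i unfolding TT_def by (rule rel_comp_in_relations[OF T T X])
  obtain P pr where po: "path_object X T N P pr" using path_object_exists[of X T] X T by blast
  then have P: "P \<in> Ob C" and pr: "\<And>i. i \<le> N \<Longrightarrow> in_hom C (pr i) P X"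
    and prT: "\<And>i. i < N \<Longrightarrow> related X (T i) P (pr i) (pr (Suc i))"
    by (simp_all add: path_object_def)
  have "\<exists>E\<in>relations C P. \<forall>W a b. related P E W a b \<longleftrightarrow>
    in_hom C a W P \<and> in_hom C b W P \<and> (\<forall>i\<in>{..N}. related X (TT i) W (pr i \<cdot> a) (pr i \<cdot> b))"
    by (rule relation_of_conditions[OF _ P]) (use TTr pr in auto)
  then obtain E where Er: "E \<in> relations C P" and E: "\<And>W a b. related P E W a b \<longleftrightarrow>
    in_hom C a W P \<and> in_hom C b W P \<and> (\<forall>i\<le>N. related X (TT i) W (pr i \<cdot> a) (pr i \<cdot> b))"
    unfolding Ball_def atMost_iff by blast
  have "related X (TT i) W a a" if "in_hom C a W X" for i W a
    unfolding TT_def by (rule rel_compI[OF T T X refl[OF that] refl[OF that]])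
  then have Erefl: "reflexive_relation C P E"
    unfolding reflexive_relation_iff[OF P] using Er E comp_in_hom pr by auto
  \<comment> \<open>the only use of the hypothesis; \<open>E\<close> lies in its \<open>n\<close>-th power by reflexivity\<close>
  have E_op: "related P (rel_pow C P E (Suc N)) W y x" if xy: "related P E W x y" for W x y
  proof -
    have x: "in_hom C x W P" using xy E by blast
    have "related P (rel_pow C P E (Suc N)) W x y"
      using rel_pow_chainI[OF Er P, of "\<lambda>i. if i \<le> N then x else y" W "Suc N"]
        x xy Erefl unfolding reflexive_relation_iff[OF P] by auto
    then show ?thesis using hyp[OF P Erefl] unfolding equivalence_relation_iff[OF P] by blast
  qed
  \<comment> \<open>the gain of one factor along one \<open>E\<close>-step\<close>
  have step: "related X (alternating C X (T (Suc i)) (T i) (Suc (Suc j))) W t b"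
    if A: "related X (alternating C X (T i) (T (Suc i)) (Suc j)) W t c" and cb: "related X (TT i) W c b" for i j W t c b
  proof -
    note hom = related_in_hom[OF alt X A] related_in_hom[OF TTr X cb]
    obtain V e m where e: "cover e V W" and cm: "related X (T i) V (c \<cdot> e) m" and mb: "related X (T (Suc i)) V m (b \<cdot> e)"
      using rel_compE[OF T T X cb[unfolded TT_def]] .
    have "related X (alternating C X (T i) (T (Suc i)) (Suc j)) V (t \<cdot> e) m"
      by (rule alternating_absorb[OF Teq T X related_comp[OF alt X A cover_in_hom[OF e]] cm])
    then have "related X (alternating C X (T (Suc i)) (T i) (Suc (Suc j))) V (t \<cdot> e) (b \<cdot> e)"
      by (rule alternating_SucI[OF T T X _ mb])
    then show ?thesis using related_descent[OF alt e] hom by blast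
  qed
  \<comment> \<open>\<open>t\<close> will be \<open>c\<^sub>N\<^sub>+\<^sub>2\<close>, which is the last coordinate of \<open>y\<close>; the first factor \<open>T\<^sub>N\<close> is thus used
    trivially, and is there to absorb the first half of the first \<open>E\<close>-step\<close>
  have claim: "related X (alternating C X (T (N - j)) (T (Suc (N - j))) (Suc j)) W t (pr (N - j) \<cdot> x)"
    if "j \<le> N" "related X (T N) W t (pr N \<cdot> y)" "related P (rel_pow C P E j) W y x" for j W t y x
    using that
  proof (induction j arbitrary: W t y x)
    case 0
    then show ?case using related_diagonal[OF P] by simp
  next
    case (Suc j)
    \<comment> \<open>\<open>T\<^sub>l\<^sub>+\<^sub>2 = T\<^sub>l\<close> keeps the two factors in play equal to \<open>T\<^sub>l\<close> and \<open>T\<^sub>l\<^sub>+\<^sub>1\<close>\<close>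
    obtain l where l: "N - j = Suc l" "N - Suc j = l" "l < N" using Suc.prems(1) by (cases "N - j") auto
    obtain V e z where e: "cover e V W" and yz: "related P (rel_pow C P E j) V (y \<cdot> e) z"
      and zx: "related P E V z (x \<cdot> e)"
      using rel_pow_SucE[OF Er P Suc.prems(3)] by blast
    have hom: "in_hom C t W X" "in_hom C y W P" "in_hom C x W P"
      using related_in_hom[OF T X Suc.prems(2)]
        related_in_hom[OF rel_pow_in_relations[OF Er P] P Suc.prems(3)] by auto
    have xe: "in_hom C (x \<cdot> e) V P" using comp_in_hom[OF cover_in_hom[OF e] hom(3)] .
    have assoc: "(pr i \<cdot> w) \<cdot> e = pr i \<cdot> (w \<cdot> e)" if "i \<le> N" "in_hom C w W P" for i w
      using comp_assoc[OF cover_in_hom[OF e] that(2) pr[OF that(1)]] .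
    have "related X (T N) V (t \<cdot> e) (pr N \<cdot> (y \<cdot> e))"
      using related_comp[OF T X Suc.prems(2) cover_in_hom[OF e]] assoc hom by simp
    then have "related X (alternating C X (T (Suc l)) (T l) (Suc j)) V (t \<cdot> e) (pr (Suc l) \<cdot> z)"
      using Suc.IH[OF _ _ yz] Suc.prems(1) l T2 by simp
    moreover have "related X (TT (Suc l)) V (pr (Suc l) \<cdot> z) (pr (Suc l) \<cdot> (x \<cdot> e))"
      using zx E l by auto
    ultimately have "related X (alternating C X (T l) (T (Suc l)) (Suc (Suc j))) V (t \<cdot> e) (pr (Suc l) \<cdot> (x \<cdot> e))"
      using step[of "Suc l"] T2 by simp
    moreover have "related X (T l) V (pr (Suc l) \<cdot> (x \<cdot> e)) (pr l \<cdot> (x \<cdot> e))"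
      using sym related_comp[OF T X prT xe] l by simp
    ultimately have "related X (alternating C X (T l) (T (Suc l)) (Suc (Suc j))) V (t \<cdot> e) (pr l \<cdot> (x \<cdot> e))"
      by (rule alternating_absorb[OF Teq T X])
    then have "related X (alternating C X (T l) (T (Suc l)) (Suc (Suc j))) V (t \<cdot> e) ((pr l \<cdot> x) \<cdot> e)"
      using assoc[of l x] hom l by simp
    moreover have "in_hom C (pr l \<cdot> x) W X" using comp_in_hom[OF hom(3) pr] l by simp
    ultimately show ?case unfolding l(2) using related_descent[OF alt e hom(1)] by blast
  qed
  have "related X (alternating C X (T 0) (T (Suc 0)) (Suc (Suc N))) W a d" using ad TR by simp
  from alternating_chainE[OF T T X this]
  obtain V e c where e: "cover e V W" and c: "c (Suc (Suc N)) = a \<cdot> e" "c 0 = d \<cdot> e"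
    and cT': "\<And>i. i < Suc (Suc N) \<Longrightarrow> related X (if even i then T 0 else T (Suc 0)) V (c (Suc i)) (c i)"
    by blast
  have cT: "related X (T i) V (c (Suc i)) (c i)" if "i < Suc (Suc N)" for i
    using cT'[OF that] by (simp add: T_def split: if_splits)
  have ch: "in_hom C (c i) V X" if "i \<le> Suc (Suc N)" for i
    using related_in_hom[OF T X cT] that by (cases i) auto
  \<comment> \<open>both the initial and the final stretch of the chain are paths, the latter as \<open>T\<close> has period \<open>2\<close>\<close>
  have "\<exists>h. in_hom C h V P \<and> (\<forall>i\<le>N. pr i \<cdot> h = c (s i))" if "s = (\<lambda>i. i) \<or> s = (\<lambda>i. Suc (Suc i))" for s
  proof -
    have 1: "\<forall>i\<le>N. in_hom C (c (s i)) V X" using ch that by auto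
    have 2: "\<forall>i<N. related X (T i) V (c (s i)) (c (s (Suc i)))"
      using sym cT that T2 by (metis Suc_lessD Suc_mono)
    have 3: "(\<forall>i\<le>N. in_hom C (x i) V X) \<and> (\<forall>i<N. related X (T i) V (x i) (x (Suc i))) \<longrightarrow>
        (\<exists>h. in_hom C h V P \<and> (\<forall>i\<le>N. pr i \<cdot> h = x i))" for x
      using po unfolding path_object_def by blast
    from 1 2 3[of "\<lambda>i. c (s i)"] show ?thesis by simp
  qed
  then obtain x y where x: "in_hom C x V P" "\<And>i. i \<le> N \<Longrightarrow> pr i \<cdot> x = c i"
    and y: "in_hom C y V P" "\<And>i. i \<le> N \<Longrightarrow> pr i \<cdot> y = c (Suc (Suc i))" by metis
  have "related X (TT i) V (c i) (c (Suc (Suc i)))" if "i \<le> N" for i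
    unfolding TT_def using rel_compI[OF T T X sym[OF cT] sym[OF cT]] that by simp
  then have "related P E V x y" using E x y by simp
  then have "related P (rel_pow C P E (Suc N)) V y x" by (rule E_op)
  then obtain U f z where f: "cover f U V" and yz: "related P (rel_pow C P E N) U (y \<cdot> f) z"
    and zx: "related P E U z (x \<cdot> f)"
    using rel_pow_SucE[OF Er P] by blast
  have assoc: "pr i \<cdot> (w \<cdot> f) = (pr i \<cdot> w) \<cdot> f" if "i \<le> N" "in_hom C w V P" for i w
    using comp_assoc[OF cover_in_hom[OF f] that(2) pr[OF that(1)]] by simp
  have "related X (T N) U (c (Suc (Suc N)) \<cdot> f) (pr N \<cdot> (y \<cdot> f))"
    using refl[OF comp_in_hom[OF cover_in_hom[OF f] ch[OF order_refl]]] assoc[OF _ y(1)] y(2) by simp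
  \<comment> \<open>\<open>N\<close> of the \<open>N + 1\<close> steps end at coordinate \<open>0\<close>; the last one stays there\<close>
  from claim[OF order_refl this yz]
  have "related X (alternating C X (T 0) (T (Suc 0)) (Suc N)) U (c (Suc (Suc N)) \<cdot> f) (pr 0 \<cdot> z)" by simp
  moreover have "related X (TT 0) U (pr 0 \<cdot> z) (c 0 \<cdot> f)"
    using zx E assoc[of 0 x] x by auto
  ultimately have "related X (alternating C X S R (Suc (Suc N))) U (c (Suc (Suc N)) \<cdot> f) (c 0 \<cdot> f)"
    using step[of 0] TR by simp
  moreover have SR: "alternating C X S R (Suc (Suc N)) \<in> relations C X" using alt[of "Suc 0" 0] unfolding TR .
  ultimately have "related X (alternating C X S R (Suc (Suc N))) V (c (Suc (Suc N))) (c 0)"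
    using related_descent[OF _ f ch ch] by simp
  then have "related X (alternating C X S R (Suc (Suc N))) V (a \<cdot> e) (d \<cdot> e)" unfolding c .
  moreover have "in_hom C a W X" "in_hom C d W X"
    using related_in_hom[OF alt[of 0 "Suc 0", unfolded TR] X ad] by auto
  ultimately show ?thesis using related_descent[OF SR e] by blast
qed

end

theorem corollary6p3:
  fixes C :: "('o, 'a) category_data" and n :: nat
  assumes "regular_category C" and "n \<ge> 1"
  shows "congruence_permutable C (n + 1) \<longleftrightarrow>
    (\<forall>X\<in>Ob C. \<forall>R. reflexive_relation C X R \<longrightarrow> equivalence_relation C X (rel_pow C X R n))"
proof -
  interpret regular_category C by fact
  obtain N where N: "n = Suc N" using assms(2) by (cases n) auto
  show ?thesis
  proof (intro iffI ballI allI impI)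
    fix X R
    assume "congruence_permutable C (n + 1)" "X \<in> Ob C" "reflexive_relation C X R"
    then show "equivalence_relation C X (rel_pow C X R n)"
      using permutable_imp_rel_pow_equivalence assms(2) by simp
  next
    assume hyp: "\<forall>X\<in>Ob C. \<forall>R. reflexive_relation C X R \<longrightarrow> equivalence_relation C X (rel_pow C X R n)"
    show "congruence_permutable C (n + 1)"
      unfolding congruence_permutable_def
    proof (intro ballI allI impI, elim conjE)
      fix X R S
      assume X: "X \<in> Ob C" and R: "equivalence_relation C X R" and S: "equivalence_relation C X S"
      then have RS: "R \<in> relations C X" "S \<in> relations C X" using equivalence_relation_iff by blast+
      have le: "related X (alternating C X S R (n + 1)) W a b"
        if "equivalence_relation C X R" "equivalence_relation C X S"
          "related X (alternating C X R S (n + 1)) W a b" for R S W a b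
        using rel_pow_equivalence_imp_alternating_le[of N X R S W a b] hyp X that unfolding N by simp
      show "alternating C X R S (n + 1) = alternating C X S R (n + 1)"
        using le[OF R S] le[OF S R]
        by (intro relation_eqI[OF alternating_in_relations[OF RS X] alternating_in_relations[OF RS(2,1) X] X]) blast
    qed
  qed
qed

end
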